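(* A generalized Riemannian space $\mathbb{GR}_N$ admits a nontrivial equitorsion geodesic mapping onto a generalized Kählerian space of the first kind $\mathbb{G}\overline{\underset{1}{\mathbb{K}}}{}_N$ if and only if, in the common coordinate system $x$ with respect to the mapping, there are tensors $\overline g_{ij}$, $\overline F^h_i$ (where $\overline g_{ij}$ is such that $\xi^h_{ij}=\overline\Gamma^h_{\underset{\vee}{ij}}-\Gamma^h_{\underset{\vee}{ij}}=0$) and a covector $\psi_i\neq0$ such that, with respect to the fourth kind of covariant derivative, $$\text{a)}\quad \overline g_{\underline{ij}\,\underset{4}{|}\,k}=2\psi_k\overline g_{\underline{ij}}+\psi_i\overline g_{\underline{jk}}+\psi_j\overline g_{\underline{ik}},$$ $$\text{b)}\quad \overline F^h_{i\underset{4}{|}k}=\overline F^h_{i\,\underset{4}{\overline{|}}\,k}-\psi_p\delta^h_k\overline F^p_i+\psi_i\overline F^h_k,$$ and $$\det(\overline g_{\underline{ij}})\neq0,\qquad \overline F^\alpha_i\overline g_{\underline{\alpha j}}+\overline F^\alpha_j\overline g_{\underline{\alpha i}}=0,\qquad \overline F^h_\alpha\overline F^\alpha_i=-\delta^h_i .$$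
   Context: Summation convention is used. A generalized Riemannian space $\mathbb{GR}_N$ is a differentiable $N$-dimensional manifold with a (in general non-symmetric) tensor $g_{ij}$; put $g_{\underline{ij}}=\frac12(g_{ij}+g_{ji})$, assume $\det(g_{\underline{ij}})\neq0$, and let $(g^{\underline{ij}})$ be the inverse matrix of $(g_{\underline{ij}})$. Its connection coefficients are $\Gamma^i_{jk}=g^{\underline{ip}}\Gamma_{p.jk}$ with $\Gamma_{i.jk}=\frac12(g_{ji,k}-g_{jk,i}+g_{ik,j})$ (comma = partial derivative). Put $\Gamma^i_{\underline{jk}}=\frac12(\Gamma^i_{jk}+\Gamma^i_{kj})$; the torsion tensor is $\Gamma^i_{\underset{\vee}{jk}}=\frac12(\Gamma^i_{jk}-\Gamma^i_{kj})$. The covariant derivatives of the first and fourth kind of a tensor $a^i_j$ are $a^i_{j\underset{1}{|}m}=a^i_{j,m}+\Gamma^i_{pm}a^p_j-\Gamma^p_{jm}a^i_p$ and $a^i_{j\underset{4}{|}m}=a^i_{j,m}+\Gamma^i_{mp}a^p_j-\Gamma^p_{jm}a^i_p$; for covariant tensors $a_{ij\underset{4}{|}m}=a_{ij,m}-\Gamma^p_{im}a_{pj}-\Gamma^p_{jm}a_{ip}$. A generalized Kählerian space of the first kind is a generalized Riemannian space together with a tensor $F^i_j$ (the structure) such that $F^h_pF^p_i=-\delta^h_i$, $g_{\underline{pq}}F^p_iF^q_j=g_{\underline{ij}}$, $g^{\underline{ij}}=g^{\underline{pq}}F^i_pF^j_q$, $F^h_{i\underset{1}{|}j}=0$ and $F^h_{i;j}=0$,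 where $(;)$ is the covariant derivative with respect to $\Gamma^i_{\underline{jk}}$. A diffeomorphism $f$ between two such spaces is geodesic if it maps geodesics (autoparallel curves of the connection) to geodesics. Points corresponding under $f$ are given the same coordinates (common coordinate system $x$). Barred objects belong to the target: $\overline\Gamma^i_{jk}$ are the connection coefficients built from $\overline g_{ij}$ by the formulas above, $\overline g_{\underline{ij}}$ is the symmetric part of $\overline g_{ij}$, and $\underset{4}{|}$, $\underset{4}{\overline{|}}$ are the covariant derivatives of the fourth kind with respect to $\Gamma$ and $\overline\Gamma$. A mapping is geodesic exactly when $\overline\Gamma^i_{jk}-\Gamma^i_{jk}=\delta^i_j\psi_k+\delta^i_k\psi_j+\xi^i_{jk}$ for a covector $\psi_i$ (then $\psi_i=\frac1{N+1}(\overline\Gamma^\alpha_{i\alpha}-\Gamma^\alpha_{i\alpha})$), where $\xi^i_{jk}=\overline\Gamma^i_{\underset{\vee}{jk}}-\Gamma^i_{\underset{\vee}{jk}}$; it is nontrivial if $\psi_i\neq0$. It is an equitorsion geodesic mapping if the torsion tensors of the two spaces are equal, i.e. $\xi^i_{jk}=0$.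
   Formalization: The right-hand side also requires the structure F̄ to be covariantly constant in the target (first kind and ;), since b) holds for every (1,1) tensor and the "if" part fails without this, e.g. on the round S⁶; ψ ≠ 0 is read as not identically zero. *)

theory Defs
  imports "HOL-Analysis.Analysis"
begin

section \<open>Smooth manifolds\<close>

definition pd :: "'n \<Rightarrow> (real^'n \<Rightarrow> real) \<Rightarrow> real^'n \<Rightarrow> real" where
  "pd k u x = frechet_derivative u (at x) (axis k 1)"

primrec Ck_on :: "nat \<Rightarrow> (real^'n) set \<Rightarrow> (real^'n \<Rightarrow> real) \<Rightarrow> bool" where
  "Ck_on 0 S u \<longleftrightarrow> continuous_on S u"
| "Ck_on (Suc k) S u \<longleftrightarrow> u differentiable_on S \<and> (\<forall>i. Ck_on k S (pd i u))"

text \<open>These notions are only used for open \<open>S\<close>.\<close>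

definition smooth_on :: "(real^'n) set \<Rightarrow> (real^'n \<Rightarrow> real) \<Rightarrow> bool" where
  "smooth_on S u \<longleftrightarrow> (\<forall>k. Ck_on k S u)"

definition smooth_vec_on :: "(real^'n) set \<Rightarrow> (real^'n \<Rightarrow> real^'m::finite) \<Rightarrow> bool" where
  "smooth_vec_on S u \<longleftrightarrow> (\<forall>i. smooth_on S (\<lambda>x. u x $ i))"

text \<open>A chart is its domain together with the coordinate map. The values of the coordinate map
  outside the domain are irrelevant.\<close>

type_synonym ('a, 'n) chart = "'a set \<times> ('a \<Rightarrow> real^'n)"

definition chart_inv :: "('a, 'n::finite) chart \<Rightarrow> real^'n \<Rightarrow> 'a" where
  "chart_inv c = inv_into (fst c) (snd c)"

definition coord_dom :: "('a, 'n::finite) chart \<Rightarrow> (real^'n) set" where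
  "coord_dom c = snd c ` fst c"

definition overlap :: "('a, 'n::finite) chart \<Rightarrow> ('a, 'n::finite) chart \<Rightarrow> (real^'n) set" where
  "overlap c d = snd c ` (fst c \<inter> fst d)"

definition trans_map :: "('a, 'n::finite) chart \<Rightarrow> ('a, 'n::finite) chart \<Rightarrow> real^'n \<Rightarrow> real^'n" where
  "trans_map c d = snd d \<circ> chart_inv c"

definition is_chart :: "'a topology \<Rightarrow> ('a, 'n::finite) chart \<Rightarrow> bool" where
  "is_chart X c \<longleftrightarrow> openin X (fst c) \<and> open (coord_dom c) \<and>
     homeomorphic_map (subtopology X (fst c)) (top_of_set (coord_dom c)) (snd c)"

definition compatible :: "('a, 'n::finite) chart \<Rightarrow> ('a, 'n::finite) chart \<Rightarrow> bool" where
  "compatible c d \<longleftrightarrow>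
     smooth_vec_on (overlap c d) (trans_map c d) \<and> smooth_vec_on (overlap d c) (trans_map d c)"

definition smooth_manifold :: "'a topology \<Rightarrow> ('a, 'n::finite) chart set \<Rightarrow> bool" where
  "smooth_manifold X A \<longleftrightarrow>
     Hausdorff_space X \<and> second_countable X \<and>
     (\<forall>c\<in>A. is_chart X c) \<and> (\<Union>c\<in>A. fst c) = topspace X \<and>
     (\<forall>c\<in>A. \<forall>d\<in>A. compatible c d) \<and>
     (\<forall>c. is_chart X c \<and> (\<forall>d\<in>A. compatible c d) \<longrightarrow> c \<in> A)"

definition smooth_map ::
    "'a topology \<Rightarrow> ('a, 'n::finite) chart set \<Rightarrow> 'b topology \<Rightarrow> ('b, 'm::finite) chart set \<Rightarrow> ('a \<Rightarrow> 'b) \<Rightarrow> bool" where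
  "smooth_map X A Y B f \<longleftrightarrow> continuous_map X Y f \<and>
     (\<forall>c\<in>A. \<forall>d\<in>B. smooth_vec_on (snd c ` {p \<in> fst c. f p \<in> fst d}) (snd d \<circ> f \<circ> chart_inv c))"

definition diffeo ::
    "'a topology \<Rightarrow> ('a, 'n::finite) chart set \<Rightarrow> 'b topology \<Rightarrow> ('b, 'n::finite) chart set \<Rightarrow> ('a \<Rightarrow> 'b) \<Rightarrow> bool" where
  "diffeo X A Y B f \<longleftrightarrow> bij_betw f (topspace X) (topspace Y) \<and> smooth_map X A Y B f \<and>
     smooth_map Y B X A (inv_into (topspace X) f)"

text \<open>The chart of the target in which \<open>f p\<close> has the coordinates that \<open>p\<close> has in \<open>c\<close>:
  the pair of \<open>c\<close> and \<open>push_chart X f c\<close> is a common coordinate system.\<close>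

definition push_chart :: "'a topology \<Rightarrow> ('a \<Rightarrow> 'b) \<Rightarrow> ('a, 'n::finite) chart \<Rightarrow> ('b, 'n::finite) chart" where
  "push_chart X f c = (f ` fst c, snd c \<circ> inv_into (topspace X) f)"


section \<open>Tensors\<close>

text \<open>A tensor is given by its components in every chart, as functions of the coordinates,
  subject to the transformation law. The first argument of a field is the chart.
  For a field \<open>G\<close> of type \<open>(0,2)\<close>, \<open>G c x $ i $ j\<close> is $G_{ij}$; for a field \<open>F\<close> of
  type \<open>(1,1)\<close>, \<open>F c x $ h $ i\<close> is $F^h_i$.\<close>

type_synonym ('a, 'n) field1 = "('a, 'n) chart \<Rightarrow> real^'n \<Rightarrow> real^'n"
type_synonym ('a, 'n) field2 = "('a, 'n) chart \<Rightarrow> real^'n \<Rightarrow> real^'n^'n"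

text \<open>\<open>jac c d x a i\<close> is the derivative of the \<open>a\<close>-th coordinate of \<open>d\<close> with respect to the
  \<open>i\<close>-th coordinate of \<open>c\<close>.\<close>

definition jac :: "('a, 'n::finite) chart \<Rightarrow> ('a, 'n::finite) chart \<Rightarrow> real^'n \<Rightarrow> 'n \<Rightarrow> 'n \<Rightarrow> real" where
  "jac c d x a i = pd i (\<lambda>y. trans_map c d y $ a) x"

definition covector_field :: "('a, 'n::finite) chart set \<Rightarrow> ('a, 'n::finite) field1 \<Rightarrow> bool" where
  "covector_field A w \<longleftrightarrow>
     (\<forall>c\<in>A. smooth_vec_on (coord_dom c) (w c)) \<and>
     (\<forall>c\<in>A. \<forall>d\<in>A. \<forall>x\<in>overlap c d. \<forall>i.
        w c x $ i = (\<Sum>a\<in>UNIV. jac c d x a i * w d (trans_map c d x) $ a))"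

definition tensor02_field :: "('a, 'n::finite) chart set \<Rightarrow> ('a, 'n::finite) field2 \<Rightarrow> bool" where
  "tensor02_field A G \<longleftrightarrow>
     (\<forall>c\<in>A. \<forall>i j. smooth_on (coord_dom c) (\<lambda>x. G c x $ i $ j)) \<and>
     (\<forall>c\<in>A. \<forall>d\<in>A. \<forall>x\<in>overlap c d. \<forall>i j.
        G c x $ i $ j =
          (\<Sum>a\<in>UNIV. \<Sum>b\<in>UNIV. jac c d x a i * jac c d x b j * G d (trans_map c d x) $ a $ b))"

definition tensor11_field :: "('a, 'n::finite) chart set \<Rightarrow> ('a, 'n::finite) field2 \<Rightarrow> bool" where
  "tensor11_field A F \<longleftrightarrow>
     (\<forall>c\<in>A. \<forall>h i. smooth_on (coord_dom c) (\<lambda>x. F c x $ h $ i)) \<and>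
     (\<forall>c\<in>A. \<forall>d\<in>A. \<forall>x\<in>overlap c d. \<forall>h i.
        F c x $ h $ i =
          (\<Sum>a\<in>UNIV. \<Sum>b\<in>UNIV. jac d c (trans_map c d x) h a * jac c d x b i
             * F d (trans_map c d x) $ a $ b))"


section \<open>Non-symmetric metrics and their connection, in one chart\<close>

text \<open>Here \<open>G\<close> is the matrix of components of the metric in a chart and \<open>C\<close> a system of connection
  coefficients in a chart: \<open>C i j k x\<close> is $\Gamma^i_{jk}(x)$.\<close>

type_synonym 'n coeffs = "'n \<Rightarrow> 'n \<Rightarrow> 'n \<Rightarrow> real^'n \<Rightarrow> real"

definition sym_part :: "(real^'n \<Rightarrow> real^'n^'n::finite) \<Rightarrow> real^'n \<Rightarrow> real^'n^'n" where
  "sym_part G x = (\<chi> i j. (G x $ i $ j + G x $ j $ i) / 2)"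

definition sym_inv :: "(real^'n \<Rightarrow> real^'n^'n::finite) \<Rightarrow> real^'n \<Rightarrow> real^'n^'n" where
  "sym_inv G x = matrix_inv (sym_part G x)"

definition conn_low :: "(real^'n \<Rightarrow> real^'n^'n::finite) \<Rightarrow> 'n::finite coeffs" where
  "conn_low G i j k x =
     (pd k (\<lambda>y. G y $ j $ i) x - pd i (\<lambda>y. G y $ j $ k) x + pd j (\<lambda>y. G y $ i $ k) x) / 2"

definition conn :: "(real^'n \<Rightarrow> real^'n^'n::finite) \<Rightarrow> 'n::finite coeffs" where
  "conn G i j k x = (\<Sum>p\<in>UNIV. sym_inv G x $ i $ p * conn_low G p j k x)"

definition conn_sym :: "'n::finite coeffs \<Rightarrow> 'n::finite coeffs" where
  "conn_sym C i j k x = (C i j k x + C i k j x) / 2"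

definition torsion :: "'n::finite coeffs \<Rightarrow> 'n::finite coeffs" where
  "torsion C i j k x = (C i j k x - C i k j x) / 2"

definition cov1_mixed :: "'n::finite coeffs \<Rightarrow> (real^'n \<Rightarrow> real^'n^'n::finite) \<Rightarrow> 'n::finite coeffs" where
  "cov1_mixed C T i j m x = pd m (\<lambda>y. T y $ i $ j) x
     + (\<Sum>p\<in>UNIV. C i p m x * T x $ p $ j) - (\<Sum>p\<in>UNIV. C p j m x * T x $ i $ p)"

definition cov4_mixed :: "'n::finite coeffs \<Rightarrow> (real^'n \<Rightarrow> real^'n^'n::finite) \<Rightarrow> 'n::finite coeffs" where
  "cov4_mixed C T i j m x = pd m (\<lambda>y. T y $ i $ j) x
     + (\<Sum>p\<in>UNIV. C i m p x * T x $ p $ j) - (\<Sum>p\<in>UNIV. C p j m x * T x $ i $ p)"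

definition cov4_low :: "'n::finite coeffs \<Rightarrow> (real^'n \<Rightarrow> real^'n^'n::finite) \<Rightarrow> 'n::finite coeffs" where
  "cov4_low C T i j m x = pd m (\<lambda>y. T y $ i $ j) x
     - (\<Sum>p\<in>UNIV. C p i m x * T x $ p $ j) - (\<Sum>p\<in>UNIV. C p j m x * T x $ i $ p)"

definition kron :: "'n \<Rightarrow> 'n \<Rightarrow> real" where
  "kron i j = (if i = j then 1 else 0)"

text \<open>The covariant derivative \<open>;\<close> is the one of the first kind for the symmetric coefficients
  \<open>conn_sym C\<close> (for those all kinds coincide). Given the compatibility of the
  mapping with the connections, the equation relating the fourth-kind derivatives of the target
  structure in the two spaces is an identity valid for every tensor of type \<open>(1,1)\<close>, so it does
  not by itself express that the structure is parallel in the target. The characterisation of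
  geodesic mappings therefore refers to \<open>structure_parallel\<close> explicitly.\<close>

definition structure_parallel :: "'n::finite coeffs \<Rightarrow> (real^'n \<Rightarrow> real^'n^'n::finite) \<Rightarrow> real^'n \<Rightarrow> bool" where
  "structure_parallel C T x \<longleftrightarrow>
     (\<forall>h i j. cov1_mixed C T h i j x = 0 \<and> cov1_mixed (conn_sym C) T h i j x = 0)"


section \<open>Generalized Riemannian and generalized Kaehlerian spaces\<close>

definition gen_riemannian ::
    "'a topology \<Rightarrow> ('a, 'n::finite) chart set \<Rightarrow> ('a, 'n::finite) field2 \<Rightarrow> bool" where
  "gen_riemannian X A g \<longleftrightarrow> smooth_manifold X A \<and> tensor02_field A g \<and>
     (\<forall>c\<in>A. \<forall>x\<in>coord_dom c. det (sym_part (g c) x) \<noteq> 0)"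

definition gen_kaehlerian1 ::
    "'a topology \<Rightarrow> ('a, 'n::finite) chart set \<Rightarrow> ('a, 'n::finite) field2 \<Rightarrow> ('a, 'n::finite) field2 \<Rightarrow> bool" where
  "gen_kaehlerian1 X A g F \<longleftrightarrow> gen_riemannian X A g \<and> tensor11_field A F \<and>
     (\<forall>c\<in>A. \<forall>x\<in>coord_dom c.
        (\<forall>h i. (\<Sum>p\<in>UNIV. F c x $ h $ p * F c x $ p $ i) = - kron h i) \<and>
        (\<forall>i j. (\<Sum>p\<in>UNIV. \<Sum>q\<in>UNIV. sym_part (g c) x $ p $ q * F c x $ p $ i * F c x $ q $ j)
               = sym_part (g c) x $ i $ j) \<and>
        (\<forall>i j. sym_inv (g c) x $ i $ j
               = (\<Sum>p\<in>UNIV. \<Sum>q\<in>UNIV. sym_inv (g c) x $ p $ q * F c x $ i $ p * F c x $ j $ q)) \<and>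
        structure_parallel (conn (g c)) (F c) x)"


section \<open>Geodesic mappings\<close>

text \<open>Autoparallel curves are taken with an arbitrary regular parameter: the covariant derivative
  of the velocity \<open>v\<close> along the curve is proportional to \<open>v\<close>.\<close>

definition autoparallel_at :: "'n::finite coeffs \<Rightarrow> (real \<Rightarrow> real^'n::finite) \<Rightarrow> real \<Rightarrow> bool" where
  "autoparallel_at C \<gamma> t \<longleftrightarrow> (\<exists>v a \<rho>.
     (\<forall>\<^sub>F s in nhds t. (\<gamma> has_vector_derivative v s) (at s)) \<and>
     (v has_vector_derivative a) (at t) \<and> v t \<noteq> 0 \<and>
     (\<forall>h. a $ h + (\<Sum>j\<in>UNIV. \<Sum>k\<in>UNIV. C h j k (\<gamma> t) * v t $ j * v t $ k) = \<rho> * v t $ h))"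

definition geodesic ::
    "'a topology \<Rightarrow> ('a, 'n::finite) chart set \<Rightarrow> ('a, 'n::finite) field2 \<Rightarrow> real \<Rightarrow> real \<Rightarrow> (real \<Rightarrow> 'a) \<Rightarrow> bool" where
  "geodesic X A g \<alpha> \<beta> l \<longleftrightarrow> \<alpha> < \<beta> \<and> continuous_map (top_of_set {\<alpha><..<\<beta>}) X l \<and>
     (\<forall>c\<in>A. \<forall>t\<in>{\<alpha><..<\<beta>}. l t \<in> fst c \<longrightarrow> autoparallel_at (conn (g c)) (snd c \<circ> l) t)"

definition geodesic_mapping ::
    "'a topology \<Rightarrow> ('a, 'n::finite) chart set \<Rightarrow> ('a, 'n::finite) field2 \<Rightarrow>
     'b topology \<Rightarrow> ('b, 'n::finite) chart set \<Rightarrow> ('b, 'n::finite) field2 \<Rightarrow> ('a \<Rightarrow> 'b) \<Rightarrow> bool" where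
  "geodesic_mapping X A g Y B gbar f \<longleftrightarrow> diffeo X A Y B f \<and>
     (\<forall>\<alpha> \<beta> l. geodesic X A g \<alpha> \<beta> l \<longrightarrow> geodesic Y B gbar \<alpha> \<beta> (f \<circ> l))"

definition equitorsion ::
    "'a topology \<Rightarrow> ('a, 'n::finite) chart set \<Rightarrow> ('a, 'n::finite) field2 \<Rightarrow> ('b, 'n::finite) field2 \<Rightarrow> ('a \<Rightarrow> 'b) \<Rightarrow> bool" where
  "equitorsion X A g gbar f \<longleftrightarrow> (\<forall>c\<in>A. \<forall>x\<in>coord_dom c. \<forall>i j k.
     torsion (conn (gbar (push_chart X f c))) i j k x = torsion (conn (g c)) i j k x)"

text \<open>The covector $\psi_i$ of a geodesic mapping, in the common coordinates given by \<open>c\<close>.\<close>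

definition mapping_covector ::
    "'a topology \<Rightarrow> ('a, 'n::finite) field2 \<Rightarrow> ('b, 'n::finite) field2 \<Rightarrow> ('a \<Rightarrow> 'b) \<Rightarrow> ('a, 'n::finite) field1" where
  "mapping_covector X g gbar f c x = (\<chi> i.
     (\<Sum>a\<in>UNIV. conn (gbar (push_chart X f c)) a i a x - conn (g c) a i a x) / (real CARD('n::finite) + 1))"

text \<open>\<open>nonzero_covector A w\<close> says that the field \<open>w\<close> does not vanish identically.\<close>

definition nonzero_covector :: "('a, 'n::finite) chart set \<Rightarrow> ('a, 'n::finite) field1 \<Rightarrow> bool" where
  "nonzero_covector A w \<longleftrightarrow> (\<exists>c\<in>A. \<exists>x\<in>coord_dom c. w c x \<noteq> 0)"

text \<open>A target space is diffeomorphic to \<open>X\<close>, so it is no restriction that its points have the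
  same type.\<close>

definition admits_equitorsion_mapping_onto_kaehlerian1 ::
    "'a topology \<Rightarrow> ('a, 'n::finite) chart set \<Rightarrow> ('a, 'n::finite) field2 \<Rightarrow> bool" where
  "admits_equitorsion_mapping_onto_kaehlerian1 X A g \<longleftrightarrow>
     (\<exists>(Y :: 'a topology) (B :: ('a, 'n::finite) chart set) gbar Fbar f.
        gen_kaehlerian1 Y B gbar Fbar \<and> geodesic_mapping X A g Y B gbar f \<and>
        equitorsion X A g gbar f \<and> nonzero_covector A (mapping_covector X g gbar f))"

end

theory Submission
  imports Defs
begin

text \<open>
  A geodesic mapping changes the connection by
  $\overline\Gamma^h_{jk} - \Gamma^h_{jk} = \delta^h_j\psi_k + \delta^h_k\psi_j$ when the torsions
  agree; this relation, called \<open>proj_related\<close> below, is the hinge of the proof. The metric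
  $\overline g_{\underline{ij}}$ is parallel of the fourth kind for its own connection, so
  $\overline g_{\underline{ij}|k}$ is linear in the difference of the connections: the relation
  gives equation a), and conversely a) determines that difference, because the defect with
  lowered index is symmetric in one pair of indices and skew in another (\<open>metric_equation_of_proj_related\<close>,
  \<open>proj_related_of_metric_equation\<close>). Equation b) is a consequence of the relation for
  every tensor of type $(1,1)$, and the skewness of $\overline F$ with respect to
  $\overline g_{\underline{ij}}$ amounts to invariance of the metric and of its inverse once
  $\overline F^2 = -1$ (\<open>hermitian_iff\<close>). The parallelism of $\overline F$ is the same on
  both sides.

  From a mapping to the equations: all tensors of the target are pulled back through the charts
  \<open>push_chart X f c\<close>, which belong to the target atlas by its maximality. To obtain the
  relation at a point one needs a geodesic of the source in every direction. It comes from the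
  Picard--Lindeloef theorem in a single chart (\<open>autoparallel_exists\<close>); that it is autoparallel
  in every other chart is the transformation law of the quadratic form
  $\Gamma^h_{jk} v^j v^k$ (\<open>spray_conn_transform\<close>), whose inhomogeneous term is the second
  derivative of the transition map. Since the image is a geodesic too, the difference of the two
  quadratic forms is a multiple of $v$ for each $v$, and polarisation on the basis vectors gives
  the relation (\<open>projective_algebra\<close>). In the difference the inhomogeneous terms of the
  transformation law cancel, which shows that $\psi$ is a covector field
  (\<open>proj_related_covector_field\<close>).

  From the equations to a mapping: the target is the same manifold with the metric
  $\overline g$, and the mapping is the identity. It preserves geodesics because the relation adds
  to $\Gamma^h_{jk} v^j v^k$ only the multiple $2\,\psi(v)\,v$ of the velocity, which the
  definition of an autoparallel curve with arbitrary parameter absorbs.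
\<close>

section \<open>Partial derivatives and smooth functions\<close>

lemma pd_eq: "(u has_derivative u') (at x) \<Longrightarrow> pd k u x = u' (axis k 1)"
  unfolding pd_def using frechet_derivative_at by metis

lemma has_derivative_pd:
  fixes u :: "real^'n \<Rightarrow> real"
  assumes "u differentiable (at x)"
  shows "(u has_derivative (\<lambda>v. \<Sum>k\<in>UNIV. v $ k * pd k u x)) (at x)"
proof -
  have d: "(u has_derivative frechet_derivative u (at x)) (at x)"
    using assms frechet_derivative_works by blast
  then have l: "linear (frechet_derivative u (at x))"
    by (simp add: assms linear_frechet_derivative)
  have "frechet_derivative u (at x) v = (\<Sum>k\<in>UNIV. v $ k * pd k u x)" for v
  proof -
    have "frechet_derivative u (at x) v = frechet_derivative u (at x) (\<Sum>k\<in>UNIV. v $ k *\<^sub>R axis k 1)"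
      by (simp add: scalar_mult_eq_scaleR[symmetric] basis_expansion)
    also have "\<dots> = (\<Sum>k\<in>UNIV. v $ k * pd k u x)"
      using l by (simp add: linear_sum linear_scale pd_def)
    finally show ?thesis .
  qed
  then have "frechet_derivative u (at x) = (\<lambda>v. \<Sum>k\<in>UNIV. v $ k * pd k u x)" by blast
  with d show ?thesis by simp
qed

lemma pd_cong_open:
  assumes "open S" "x \<in> S" "\<And>y. y \<in> S \<Longrightarrow> u y = v y"
  shows "pd k u x = pd k v x"
proof -
  have "(u has_derivative D) (at x) = (v has_derivative D) (at x)" for D
    using assms has_derivative_transform_within_open[of u D x UNIV S v]
      has_derivative_transform_within_open[of v D x UNIV S u] by fastforce
  then show ?thesis unfolding pd_def frechet_derivative_def by simp
qed

lemma sum_axis_mult: "(\<Sum>i\<in>UNIV. axis k 1 $ i * f i) = (f k :: real)"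
proof -
  have "(\<Sum>i\<in>UNIV. axis k 1 $ i * f i) = (\<Sum>i\<in>UNIV. if i = k then f i else 0)"
    by (intro sum.cong) (auto simp: axis_def)
  then show ?thesis by simp
qed

lemma pd_const: "pd k (\<lambda>x. c) = (\<lambda>x. 0)" by (rule ext) (simp add: pd_def)

lemma pd_add:
  assumes "u differentiable (at x)" "v differentiable (at x)"
  shows "pd k (\<lambda>y. u y + v y) x = pd k u x + pd k v x"
  using pd_eq[OF has_derivative_add[OF has_derivative_pd[OF assms(1)] has_derivative_pd[OF assms(2)]]]
  by (simp add: sum_axis_mult)

lemma pd_mult:
  assumes "u differentiable (at x)" "v differentiable (at x)"
  shows "pd k (\<lambda>y. u y * v y) x = pd k u x * v x + u x * pd k v x"
  using pd_eq[OF has_derivative_mult[OF has_derivative_pd[OF assms(1)] has_derivative_pd[OF assms(2)]]]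
  by (simp add: sum_axis_mult)

lemma pd_inverse:
  assumes "u differentiable (at x)" "u x \<noteq> 0"
  shows "pd k (\<lambda>y. inverse (u y)) x = - (pd k u x * (inverse (u x) * inverse (u x)))"
  using pd_eq[OF Deriv.has_derivative_inverse[OF assms(2) has_derivative_pd[OF assms(1)]]]
  by (simp add: sum_axis_mult mult.assoc)

lemma differentiable_at_of_open:
  "open S \<Longrightarrow> u differentiable_on S \<Longrightarrow> x \<in> S \<Longrightarrow> u differentiable (at x)"
  unfolding differentiable_on_def by (metis at_within_open)

lemma differentiable_on_cong_open:
  assumes "open S" "\<And>y. y \<in> S \<Longrightarrow> u y = v y" "u differentiable_on S"
  shows "v differentiable_on S"
  unfolding differentiable_on_def
proof
  fix x assume x: "x \<in> S"
  then have "u differentiable (at x within S)" using assms(3) by (simp add: differentiable_on_def)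
  then show "v differentiable (at x within S)"
    by (rule differentiable_transform_within[OF _ zero_less_one x]) (use assms(2) in simp)
qed

lemma Ck_on_cong:
  assumes "open S" "\<And>y. y \<in> S \<Longrightarrow> u y = v y" "Ck_on k S u"
  shows "Ck_on k S v"
  using assms(2,3)
proof (induction k arbitrary: u v)
  case 0
  then show ?case using continuous_on_cong[of S S u v] by simp
next
  case (Suc k)
  have "Ck_on k S (pd i v)" for i
  proof (rule Suc.IH)
    show "pd i u y = pd i v y" if "y \<in> S" for y
      using pd_cong_open[OF assms(1) that] Suc.prems(1) by blast
    show "Ck_on k S (pd i u)" using Suc.prems(2) by (simp only: Ck_on.simps)
  qed
  moreover have "v differentiable_on S"
    using differentiable_on_cong_open[OF assms(1) Suc.prems(1)] Suc.prems(2) by (simp only: Ck_on.simps)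
  ultimately show ?case unfolding Ck_on.simps by blast
qed

lemma Ck_on_SucD: "Ck_on (Suc k) S u \<Longrightarrow> Ck_on k S u"
proof (induction k arbitrary: u)
  case 0
  then show ?case unfolding Ck_on.simps by (blast intro: differentiable_imp_continuous_on)
next
  case (Suc k)
  then show ?case by (metis Ck_on.simps(2))
qed

lemma Ck_on_const: "Ck_on k S (\<lambda>x. c)"
proof (induction k arbitrary: c)
  case 0
  show ?case unfolding Ck_on.simps by (rule continuous_on_const)
next
  case (Suc k)
  show ?case unfolding Ck_on.simps pd_const using Suc.IH[of 0] by simp
qed

lemma Ck_on_add:
  assumes "open S" "Ck_on k S u" "Ck_on k S v"
  shows "Ck_on k S (\<lambda>x. u x + v x)"
  using assms(2,3)
proof (induction k arbitrary: u v)
  case 0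
  then show ?case using continuous_on_add[of S u v] by simp
next
  case (Suc k)
  have d: "u differentiable_on S" "v differentiable_on S" using Suc.prems by (simp_all only: Ck_on.simps)
  have "Ck_on k S (pd i (\<lambda>x. u x + v x))" for i
  proof (rule Ck_on_cong[OF assms(1)])
    show "Ck_on k S (\<lambda>x. pd i u x + pd i v x)"
      by (rule Suc.IH) (use Suc.prems in \<open>simp_all only: Ck_on.simps\<close>)
    show "pd i u y + pd i v y = pd i (\<lambda>x. u x + v x) y" if "y \<in> S" for y
      by (rule pd_add[symmetric]) (rule differentiable_at_of_open[OF assms(1) _ that], fact d)+
  qed
  with differentiable_on_add[OF d] show ?case unfolding Ck_on.simps by blast
qed

lemma Ck_on_mult:
  assumes "open S" "Ck_on k S u" "Ck_on k S v"
  shows "Ck_on k S (\<lambda>x. u x * v x)"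
  using assms(2,3)
proof (induction k arbitrary: u v)
  case 0
  then show ?case using continuous_on_mult[of S u v] by simp
next
  case (Suc k)
  have d: "u differentiable_on S" "v differentiable_on S" using Suc.prems by (simp_all only: Ck_on.simps)
  have "Ck_on k S (pd i (\<lambda>x. u x * v x))" for i
  proof (rule Ck_on_cong[OF assms(1)])
    show "Ck_on k S (\<lambda>x. pd i u x * v x + u x * pd i v x)"
    proof (rule Ck_on_add[OF assms(1)]; rule Suc.IH)
      show "Ck_on k S (pd i u)" "Ck_on k S (pd i v)" using Suc.prems by (simp_all only: Ck_on.simps)
      show "Ck_on k S u" "Ck_on k S v" by (fact Ck_on_SucD[OF Suc.prems(1)] Ck_on_SucD[OF Suc.prems(2)])+
    qed
    show "pd i u y * v y + u y * pd i v y = pd i (\<lambda>x. u x * v x) y" if "y \<in> S" for y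
      by (rule pd_mult[symmetric]) (rule differentiable_at_of_open[OF assms(1) _ that], fact d)+
  qed
  with differentiable_on_mult[OF d] show ?case unfolding Ck_on.simps by blast
qed

lemma Ck_on_inverse:
  assumes "open S" "Ck_on k S u" "\<And>x. x \<in> S \<Longrightarrow> u x \<noteq> 0"
  shows "Ck_on k S (\<lambda>x. inverse (u x))"
  using assms(2,3)
proof (induction k)
  case 0
  then show ?case using continuous_on_inverse[of S u] by simp
next
  case (Suc k)
  have d: "u differentiable_on S" using Suc.prems(1) by (simp only: Ck_on.simps)
  have Ik: "Ck_on k S (\<lambda>x. inverse (u x))" using Suc Ck_on_SucD by blast
  have "Ck_on k S (pd i (\<lambda>x. inverse (u x)))" for i
  proof (rule Ck_on_cong[OF assms(1)])
    show "Ck_on k S (\<lambda>x. (-1) * (pd i u x * (inverse (u x) * inverse (u x))))"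
    proof (intro Ck_on_mult[OF assms(1)] Ck_on_const Ik)
      show "Ck_on k S (pd i u)" using Suc.prems by (simp only: Ck_on.simps)
    qed
    show "(-1) * (pd i u y * (inverse (u y) * inverse (u y))) = pd i (\<lambda>x. inverse (u x)) y" if "y \<in> S" for y
      using pd_inverse[OF differentiable_at_of_open[OF assms(1) d that] Suc.prems(2)[OF that]] by simp
  qed
  with differentiable_on_inverse[OF d] Suc.prems show ?case unfolding Ck_on.simps by blast
qed

declare Ck_on.simps [simp del]

lemma smooth_on_cong: "open S \<Longrightarrow> (\<And>y. y \<in> S \<Longrightarrow> u y = v y) \<Longrightarrow> smooth_on S u \<Longrightarrow> smooth_on S v"
  unfolding smooth_on_def using Ck_on_cong by blast

lemma smooth_on_const: "smooth_on S (\<lambda>x. c)"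
  unfolding smooth_on_def by (simp add: Ck_on_const)

lemma smooth_on_add: "open S \<Longrightarrow> smooth_on S u \<Longrightarrow> smooth_on S v \<Longrightarrow> smooth_on S (\<lambda>x. u x + v x)"
  unfolding smooth_on_def by (simp add: Ck_on_add)

lemma smooth_on_mult: "open S \<Longrightarrow> smooth_on S u \<Longrightarrow> smooth_on S v \<Longrightarrow> smooth_on S (\<lambda>x. u x * v x)"
  unfolding smooth_on_def by (simp add: Ck_on_mult)

lemma smooth_on_diff: 
  assumes "open S" "smooth_on S u" "smooth_on S v" shows "smooth_on S (\<lambda>x. u x - v x)"
  using smooth_on_add[OF assms(1,2) smooth_on_mult[OF assms(1) smooth_on_const[of S "-1"] assms(3)]] by simp

lemma smooth_on_divide:
  assumes "open S" "smooth_on S u" "smooth_on S v" "\<And>x. x \<in> S \<Longrightarrow> v x \<noteq> 0"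
  shows "smooth_on S (\<lambda>x. u x / v x)"
proof -
  have "smooth_on S (\<lambda>x. inverse (v x))"
    unfolding smooth_on_def
  proof
    fix k
    show "Ck_on k S (\<lambda>x. inverse (v x))"
      by (rule Ck_on_inverse[OF assms(1) _ assms(4)]) (use assms(3) in \<open>simp_all add: smooth_on_def\<close>)
  qed
  from smooth_on_mult[OF assms(1,2) this] show ?thesis by (simp add: divide_inverse)
qed

lemma smooth_on_sum:
  "open S \<Longrightarrow> (\<And>i. i \<in> I \<Longrightarrow> smooth_on S (u i)) \<Longrightarrow> smooth_on S (\<lambda>x. \<Sum>i\<in>I. u i x)"
  by (induction I rule: infinite_finite_induct) (auto intro: smooth_on_const smooth_on_add)

lemma smooth_on_prod:
  "open S \<Longrightarrow> (\<And>i. i \<in> I \<Longrightarrow> smooth_on S (u i)) \<Longrightarrow> smooth_on S (\<lambda>x. \<Prod>i\<in>I. u i x)"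
  by (induction I rule: infinite_finite_induct) (auto intro: smooth_on_const smooth_on_mult)

lemma smooth_on_pd: "smooth_on S u \<Longrightarrow> smooth_on S (pd i u)"
  unfolding smooth_on_def by (metis Ck_on.simps(2))

lemma smooth_on_differentiable: "open S \<Longrightarrow> smooth_on S u \<Longrightarrow> x \<in> S \<Longrightarrow> u differentiable (at x)"
  unfolding smooth_on_def by (metis Ck_on.simps(2) differentiable_at_of_open)

lemma smooth_on_continuous: "smooth_on S u \<Longrightarrow> continuous_on S u"
  unfolding smooth_on_def by (metis Ck_on.simps(1))

lemma smooth_on_det:
  assumes "open S" "\<And>i j. smooth_on S (\<lambda>x. M x $ i $ j)"
  shows "smooth_on S (\<lambda>x. det (M x))"
  unfolding det_def by (intro smooth_on_sum smooth_on_mult smooth_on_prod smooth_on_const assms)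

lemma matrix_inv_right_det:
  fixes M :: "real^'n^'n"
  assumes "det M \<noteq> 0"
  shows "M ** matrix_inv M = mat 1" "matrix_inv M ** M = mat 1"
proof -
  have "\<exists>B. M ** B = mat 1 \<and> B ** M = mat 1"
    using assms invertible_det_nz[of M] unfolding invertible_def by blast
  then have "M ** matrix_inv M = mat 1 \<and> matrix_inv M ** M = mat 1"
    unfolding matrix_inv_def by (rule someI_ex)
  then show "M ** matrix_inv M = mat 1" "matrix_inv M ** M = mat 1" by auto
qed

text \<open>Cramer's rule writes the entries of the inverse as quotients of polynomials in the entries of
  the matrix; this is why the connection coefficients depend smoothly on the point.\<close>

lemma matrix_inv_cramer:
  fixes M :: "real^'n^'n"
  assumes "det M \<noteq> 0"
  shows "matrix_inv M $ k $ p = det (\<chi> i j. if j = k then axis p 1 $ i else M $ i $ j) / det M"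
proof -
  have "M *v (matrix_inv M *v axis p 1) = axis p 1"
    by (simp add: matrix_vector_mul_assoc matrix_inv_right_det[OF assms])
  then have "matrix_inv M *v axis p 1 = (\<chi> k. det(\<chi> i j. if j=k then axis p 1 $ i else M$i$j) / det M)"
    using cramer[OF assms] by blast
  moreover have "(matrix_inv M *v axis p 1) $ k = matrix_inv M $ k $ p"
    by (simp add: matrix_vector_mult_basis column_def)
  ultimately show ?thesis by (metis (no_types, lifting) vec_lambda_beta)
qed

lemma smooth_on_matrix_inv:
  fixes M :: "real^'m \<Rightarrow> real^'n^'n"
  assumes "open S" "\<And>i j. smooth_on S (\<lambda>x. M x $ i $ j)" "\<And>x. x \<in> S \<Longrightarrow> det (M x) \<noteq> 0"
  shows "smooth_on S (\<lambda>x. matrix_inv (M x) $ k $ p)"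
proof (rule smooth_on_cong[OF assms(1)])
  show "smooth_on S (\<lambda>x. det (\<chi> i j. if j = k then axis p 1 $ i else M x $ i $ j) / det (M x))"
  proof (intro smooth_on_divide assms smooth_on_det)
    show "smooth_on S (\<lambda>x. (\<chi> i j. if j = k then axis p 1 $ i else M x $ i $ j) $ i $ j)" for i j
      using assms(2) smooth_on_const by (cases "j = k") auto
  qed
  show "det (\<chi> i j. if j = k then axis p 1 $ i else M y $ i $ j) / det (M y) = matrix_inv (M y) $ k $ p"
    if "y \<in> S" for y using matrix_inv_cramer[OF assms(3)[OF that]] by simp
qed

lemma smooth_on_sym_part:
  assumes "open S" "\<And>i j. smooth_on S (\<lambda>x. G x $ i $ j)"
  shows "smooth_on S (\<lambda>x. sym_part G x $ i $ j)"
  unfolding sym_part_def by (simp, intro smooth_on_divide smooth_on_add smooth_on_const assms) simp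

lemma smooth_on_conn:
  assumes "open S" "\<And>i j. smooth_on S (\<lambda>x. G x $ i $ j)" "\<And>x. x \<in> S \<Longrightarrow> det (sym_part G x) \<noteq> 0"
  shows "smooth_on S (conn G i j k)"
proof -
  have "smooth_on S (\<lambda>x. sym_inv G x $ i $ p)" for i p
    unfolding sym_inv_def by (intro smooth_on_matrix_inv smooth_on_sym_part assms)
  moreover have "smooth_on S (\<lambda>x. conn_low G i j k x)" for i j k
    unfolding conn_low_def
    by (intro smooth_on_divide smooth_on_diff smooth_on_add smooth_on_const smooth_on_pd assms) simp
  ultimately have "smooth_on S (\<lambda>x. conn G i j k x)"
    unfolding conn_def by (intro smooth_on_sum smooth_on_mult assms)
  then show ?thesis by simp
qed

section \<open>Symmetry of second partial derivatives\<close>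

lemma pd_along_line:
  fixes u :: "real^'n \<Rightarrow> real"
  assumes "u differentiable (at (y + s *\<^sub>R axis i 1))"
  shows "((\<lambda>s. u (y + s *\<^sub>R axis i 1)) has_real_derivative pd i u (y + s *\<^sub>R axis i 1)) (at s)"
proof -
  let ?D = "\<lambda>v. \<Sum>k\<in>UNIV. v $ k * pd k u (y + s *\<^sub>R axis i 1)"
  have "((\<lambda>s. u (y + s *\<^sub>R axis i 1)) has_derivative (\<lambda>h. ?D (h *\<^sub>R axis i 1))) (at s)"
    by (rule has_derivative_compose[where g = u and f = "\<lambda>s. y + s *\<^sub>R axis i 1"])
      (auto intro!: derivative_eq_intros has_derivative_pd[OF assms])
  moreover have "?D (h *\<^sub>R axis i 1) = h * pd i u (y + s *\<^sub>R axis i 1)" for h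
  proof -
    have "?D (h *\<^sub>R axis i 1) = (\<Sum>k\<in>UNIV. if k = i then h * pd k u (y + s *\<^sub>R axis i 1) else 0)"
      by (intro sum.cong) (auto simp: axis_def)
    then show ?thesis by simp
  qed
  ultimately show ?thesis unfolding has_field_derivative_def by (simp add: mult_commute_abs)
qed

text \<open>The mean value theorem, applied first in direction \<open>i\<close> and then in direction \<open>j\<close>, expresses
  the second difference over a square of side \<open>h\<close> by one value of a mixed derivative in that square.
  The left-hand side is symmetric in \<open>i\<close> and \<open>j\<close>.\<close>

lemma mixed_increment:
  fixes u :: "real^'n \<Rightarrow> real"
  assumes "h > 0"
    and box: "\<And>s t. 0 \<le> s \<Longrightarrow> s \<le> h \<Longrightarrow> 0 \<le> t \<Longrightarrow> t \<le> h \<Longrightarrow>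
      u differentiable (at (x + s *\<^sub>R axis i 1 + t *\<^sub>R axis j 1)) \<and>
      pd i u differentiable (at (x + s *\<^sub>R axis i 1 + t *\<^sub>R axis j 1))"
  shows "\<exists>s t. 0 \<le> s \<and> s \<le> h \<and> 0 \<le> t \<and> t \<le> h \<and>
     u (x + h *\<^sub>R axis i 1 + h *\<^sub>R axis j 1) - u (x + h *\<^sub>R axis i 1) - u (x + h *\<^sub>R axis j 1) + u x
      = h * (h * pd j (pd i u) (x + s *\<^sub>R axis i 1 + t *\<^sub>R axis j 1))"
proof -
  let ?ei = "axis i (1::real) :: real^'n" and ?ej = "axis j (1::real) :: real^'n"
  define \<phi> where "\<phi> s = u (x + h *\<^sub>R ?ej + s *\<^sub>R ?ei) - u (x + s *\<^sub>R ?ei)" for s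
  have d1: "DERIV \<phi> s :> pd i u (x + h *\<^sub>R ?ej + s *\<^sub>R ?ei) - pd i u (x + s *\<^sub>R ?ei)"
    if "0 \<le> s" "s \<le> h" for s
    unfolding \<phi>_def using box[of s h] box[of s 0] that assms(1)
    by (intro DERIV_diff pd_along_line) (auto simp: algebra_simps)
  obtain s where s: "0 < s" "s < h"
    "\<phi> h - \<phi> 0 = (h - 0) * (pd i u (x + h *\<^sub>R ?ej + s *\<^sub>R ?ei) - pd i u (x + s *\<^sub>R ?ei))"
    using MVT2[OF assms(1), of \<phi>, OF d1] by metis
  define \<eta> where "\<eta> t = pd i u (x + s *\<^sub>R ?ei + t *\<^sub>R ?ej)" for t
  have d2: "DERIV \<eta> t :> pd j (pd i u) (x + s *\<^sub>R ?ei + t *\<^sub>R ?ej)" if "0 \<le> t" "t \<le> h" for t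
    unfolding \<eta>_def using box[of s t] s that by (intro pd_along_line) auto
  obtain t where t: "0 < t" "t < h" "\<eta> h - \<eta> 0 = (h - 0) * pd j (pd i u) (x + s *\<^sub>R ?ei + t *\<^sub>R ?ej)"
    using MVT2[OF assms(1), of \<eta>, OF d2] by metis
  have "\<phi> h - \<phi> 0 = h * (\<eta> h - \<eta> 0)"
    using s(3) unfolding \<eta>_def by (simp add: algebra_simps)
  then have "\<phi> h - \<phi> 0 = h * (h * pd j (pd i u) (x + s *\<^sub>R ?ei + t *\<^sub>R ?ej))" using t(3) by simp
  then show ?thesis
    using s(1,2) t(1,2) unfolding \<phi>_def
    by (intro exI[of _ s] exI[of _ t]) (simp add: algebra_simps)
qed

text \<open>Evaluating the same second difference in both orders yields a point where \<open>pd j (pd i u)\<close>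
  and a point where \<open>pd i (pd j u)\<close> take equal values, both as close to \<open>x\<close> as desired;
  continuity of the two functions does the rest.\<close>

lemma pd_commute:
  fixes u :: "real^'n \<Rightarrow> real"
  assumes S: "open S" "smooth_on S u" "x \<in> S"
  shows "pd i (pd j u) x = pd j (pd i u) x"
proof (rule ccontr)
  let ?a = "pd i (pd j u)" and ?b = "pd j (pd i u)"
  let ?ei = "axis i (1::real) :: real^'n" and ?ej = "axis j (1::real) :: real^'n"
  assume ne: "?a x \<noteq> ?b x"
  define e where "e = \<bar>?a x - ?b x\<bar> / 2"
  have e: "e > 0" using ne by (simp add: e_def)
  have "continuous_on S ?a" "continuous_on S ?b"
    using smooth_on_pd[OF smooth_on_pd[OF S(2)]] by (simp_all add: smooth_on_continuous)
  then obtain d1 d2 where d1: "d1 > 0" "\<And>y. y \<in> S \<Longrightarrow> dist y x < d1 \<Longrightarrow> dist (?a y) (?a x) < e"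
    and d2: "d2 > 0" "\<And>y. y \<in> S \<Longrightarrow> dist y x < d2 \<Longrightarrow> dist (?b y) (?b x) < e"
    using S(3) e unfolding continuous_on_iff by metis
  obtain d3 where d3: "d3 > 0" "ball x d3 \<subseteq> S" using S openE by blast
  define h where "h = min d1 (min d2 d3) / 3"
  have h: "h > 0" "2 * h < d1" "2 * h < d2" "2 * h < d3" using d1 d2 d3 by (auto simp: h_def)
  have near: "dist (x + s *\<^sub>R axis k 1 + t *\<^sub>R axis l 1) x \<le> 2 * h"
    if "0 \<le> s" "s \<le> h" "0 \<le> t" "t \<le> h" for s t and k l :: 'n
  proof -
    have "dist (x + s *\<^sub>R axis k 1 + t *\<^sub>R axis l 1) x = norm (s *\<^sub>R axis k 1 + t *\<^sub>R axis l (1::real))"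
      by (simp add: dist_norm add.assoc)
    also have "\<dots> \<le> s + t" using that by (intro norm_triangle_le) simp
    finally show ?thesis using that by simp
  qed
  have box: "x + s *\<^sub>R axis k 1 + t *\<^sub>R axis l 1 \<in> S"
    if "0 \<le> s" "s \<le> h" "0 \<le> t" "t \<le> h" for s t and k l :: 'n
    using near[OF that, of k l] h(4) d3(2) by (auto simp: subset_iff dist_commute)
  have diff: "u differentiable (at y) \<and> pd k u differentiable (at y)" if "y \<in> S" for y k
    using that S smooth_on_differentiable smooth_on_pd by blast
  obtain s t where st: "0 \<le> s" "s \<le> h" "0 \<le> t" "t \<le> h"
     "u (x + h *\<^sub>R ?ei + h *\<^sub>R ?ej) - u (x + h *\<^sub>R ?ei) - u (x + h *\<^sub>R ?ej) + u x
      = h * (h * ?b (x + s *\<^sub>R ?ei + t *\<^sub>R ?ej))"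
    using mixed_increment[OF h(1), of u x i j] box diff by meson
  obtain s' t' where st': "0 \<le> s'" "s' \<le> h" "0 \<le> t'" "t' \<le> h"
     "u (x + h *\<^sub>R ?ej + h *\<^sub>R ?ei) - u (x + h *\<^sub>R ?ej) - u (x + h *\<^sub>R ?ei) + u x
      = h * (h * ?a (x + s' *\<^sub>R ?ej + t' *\<^sub>R ?ei))"
    using mixed_increment[OF h(1), of u x j i] box diff by meson
  have "h * (h * ?b (x + s *\<^sub>R ?ei + t *\<^sub>R ?ej)) = h * (h * ?a (x + s' *\<^sub>R ?ej + t' *\<^sub>R ?ei))"
    using st(5) st'(5) by (simp add: algebra_simps)
  then have eq: "?b (x + s *\<^sub>R ?ei + t *\<^sub>R ?ej) = ?a (x + s' *\<^sub>R ?ej + t' *\<^sub>R ?ei)" using h(1) by simp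
  have "dist (?b (x + s *\<^sub>R ?ei + t *\<^sub>R ?ej)) (?b x) < e"
    using d2(2)[OF box[OF st(1-4)]] near[OF st(1-4), of i j] h(3) by simp
  moreover have "dist (?a (x + s' *\<^sub>R ?ej + t' *\<^sub>R ?ei)) (?a x) < e"
    using d1(2)[OF box[OF st'(1-4)]] near[OF st'(1-4), of j i] h(2) by simp
  ultimately have "\<bar>?a x - ?b x\<bar> < 2 * e" using eq by (simp add: dist_real_def)
  then show False by (simp add: e_def)
qed

section \<open>Local existence of autoparallel curves\<close>

text \<open>Precomposing \<open>F\<close> with the projection onto the ball gives a globally Lipschitz field, so that
  the Picard operator is defined on all bounded continuous functions and Banach's fixed point theorem
  applies without any estimate keeping the iterates inside the ball. Near time \<open>0\<close> the fixed
  point stays in the ball, where the modified field is \<open>F\<close>.\<close>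

lemma picard_lindelof:
  fixes F :: "'a::euclidean_space \<Rightarrow> 'a"
  assumes r: "r > 0" and L: "L-lipschitz_on (cball y0 r) F"
  shows "\<exists>h>0. \<exists>y. y 0 = y0 \<and>
    (\<forall>t\<in>{-h<..<h}. y t \<in> cball y0 r \<and> (y has_vector_derivative F (y t)) (at t))"
proof -
  define P where "P = closest_point (cball y0 r)"
  have Pin: "P x \<in> cball y0 r" for x
    unfolding P_def using r by (intro closest_point_in_set) auto
  have Pid: "P x = x" if "x \<in> cball y0 r" for x
    unfolding P_def using that by (rule closest_point_self)
  have Plip: "dist (P x) (P y) \<le> dist x y" for x y
    unfolding P_def using r by (intro closest_point_lipschitz) auto
  define G where "G = (\<lambda>x. F (P x))"
  have L0: "L \<ge> 0" using L lipschitz_on_nonneg by blast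
  have Glip: "dist (G x) (G y) \<le> L * dist x y" for x y
  proof -
    have "dist (G x) (G y) \<le> L * dist (P x) (P y)"
      unfolding G_def by (rule lipschitz_onD[OF L Pin Pin])
    also have "\<dots> \<le> L * dist x y" using Plip L0 by (rule mult_left_mono)
    finally show ?thesis .
  qed
  have Gcont: "continuous_on U G" for U
    using lipschitz_on_continuous_on[of L U G] L0 Glip by (auto simp: lipschitz_on_def)
  \<comment> \<open>An integral from \<open>-h\<close> costs at most \<open>2 * h\<close> and its value at time \<open>0\<close> at most \<open>h\<close>, hence the contraction constant \<open>3 * h * L\<close>.\<close>
  define h where "h = 1 / (6 * (L + 1))"
  have h: "h > 0" "3 * h * L < 1" "0 \<le> 3 * h * L" using L0 by (auto simp: h_def field_simps)
  \<comment> \<open>Stopping time at the ends of the interval makes the solutions bounded functions on the whole line.\<close>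
  define clamp where "clamp t = max (-h) (min h t)" for t :: real
  have clamp: "clamp t \<in> {-h..h}" for t using h(1) by (auto simp: clamp_def)
  have clamp_cont: "continuous_on U clamp" for U
    unfolding clamp_def by (intro continuous_intros)
  define I where "I y t = integral {-h..t} (\<lambda>s. G (apply_bcontfun y s))" for y :: "real \<Rightarrow>\<^sub>C 'a" and t
  have cont: "continuous_on U (\<lambda>s. G (apply_bcontfun y s))" for U and y :: "real \<Rightarrow>\<^sub>C 'a"
    by (rule continuous_on_compose2[OF Gcont[of UNIV]]) auto
  have Ider: "(I y has_vector_derivative G (apply_bcontfun y t)) (at t within {-h..h})"
    if "t \<in> {-h..h}" for y t
    unfolding I_def by (rule integral_has_vector_derivative[OF cont that])
  have Icont: "continuous_on {-h..h} (I y)" for y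
    using Ider has_vector_derivative_continuous continuous_on_eq_continuous_within by blast
  define \<Phi>0 where "\<Phi>0 y t = y0 + (I y (clamp t) - I y 0)" for y t
  have bc: "\<Phi>0 y \<in> bcontfun" for y
  proof -
    have "continuous_on UNIV (\<lambda>t. I y (clamp t))"
      by (rule continuous_on_compose2[OF Icont clamp_cont]) (use clamp in auto)
    then have 1: "continuous_on UNIV (\<Phi>0 y)" unfolding \<Phi>0_def by (intro continuous_intros)
    have "bounded (I y ` {-h..h})"
      using Icont by (intro compact_imp_bounded compact_continuous_image) auto
    then obtain B where B: "norm (I y t) \<le> B" if "t \<in> {-h..h}" for t
      unfolding bounded_iff by blast
    have "norm (\<Phi>0 y t) \<le> norm y0 + (B + norm (I y 0))" for t
      unfolding \<Phi>0_def using B[OF clamp[of t]]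
      by (metis (no_types, opaque_lifting) add_left_mono add_right_mono norm_triangle_ineq norm_triangle_ineq4 order_trans)
    then have "bounded (range (\<Phi>0 y))" unfolding bounded_iff by blast
    with 1 show ?thesis by (simp add: bcontfun_def)
  qed
  define \<Phi> where "\<Phi> y = Bcontfun (\<Phi>0 y)" for y
  have \<Phi>: "apply_bcontfun (\<Phi> y) t = \<Phi>0 y t" for y t
    unfolding \<Phi>_def using bc by (simp add: Bcontfun_inverse)
  have Idist: "norm (I y t - I z t - (I y 0 - I z 0)) \<le> 3 * h * L * dist y z" if t: "t \<in> {-h..h}" for y z t
  proof -
    have *: "norm (I y s - I z s) \<le> L * dist y z * (s - (-h))" if "s \<in> {-h..h}" for s
    proof -
      have "I y s - I z s = integral {-h..s} (\<lambda>s. G (apply_bcontfun y s) - G (apply_bcontfun z s))"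
        unfolding I_def by (intro Henstock_Kurzweil_Integration.integral_diff[symmetric] integrable_continuous_real cont)
      moreover have "norm (integral {-h..s} (\<lambda>s. G (apply_bcontfun y s) - G (apply_bcontfun z s)))
         \<le> (L * dist y z) * (s - (-h))"
      proof (rule integral_bound)
        show "- h \<le> s" using that by simp
        show "continuous_on {-h..s} (\<lambda>s. G (apply_bcontfun y s) - G (apply_bcontfun z s))"
          by (intro continuous_intros cont)
        show "norm (G (apply_bcontfun y u) - G (apply_bcontfun z u)) \<le> L * dist y z" for u
          using Glip[of "apply_bcontfun y u" "apply_bcontfun z u"]
            mult_left_mono[OF dist_bounded[of y u z] L0] by (simp add: dist_norm)
      qed
      ultimately show ?thesis by simp
    qed
    have k: "0 \<le> L * dist y z" using L0 by simp
    have "norm (I y t - I z t) \<le> L * dist y z * (2 * h)"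
      using *[OF t] mult_left_mono[OF _ k, of "t - (-h)" "2 * h"] t by auto
    moreover have "norm (I y 0 - I z 0) \<le> L * dist y z * h" using *[of 0] h(1) by simp
    moreover have "norm (I y t - I z t - (I y 0 - I z 0)) \<le> norm (I y t - I z t) + norm (I y 0 - I z 0)"
      by (rule norm_triangle_ineq4)
    ultimately show ?thesis by (simp add: algebra_simps)
  qed
  have "dist (\<Phi> y) (\<Phi> z) \<le> 3 * h * L * dist y z" for y z
  proof (rule dist_bound)
    fix t
    have "dist (apply_bcontfun (\<Phi> y) t) (apply_bcontfun (\<Phi> z) t)
       = norm (I y (clamp t) - I z (clamp t) - (I y 0 - I z 0))"
      by (simp add: \<Phi> \<Phi>0_def dist_norm algebra_simps)
    then show "dist (apply_bcontfun (\<Phi> y) t) (apply_bcontfun (\<Phi> z) t) \<le> 3 * h * L * dist y z"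
      using Idist[OF clamp] by simp
  qed
  then obtain y where y: "\<Phi> y = y" using banach_fix_type[OF h(3,2), of \<Phi>] by metis
  define w where "w = apply_bcontfun y"
  have weq: "w t = y0 + (I y t - I y 0)" if "t \<in> {-h..h}" for t
  proof -
    have "clamp t = t" using that by (auto simp: clamp_def)
    then show ?thesis using \<Phi>[of y t] y by (simp add: w_def \<Phi>0_def)
  qed
  have w0: "w 0 = y0" using weq[of 0] h(1) by simp
  have wder: "(w has_vector_derivative G (w t)) (at t)" if t: "t \<in> {-h<..<h}" for t
  proof -
    have "(I y has_vector_derivative G (w t)) (at t within {-h<..<h})"
      using t unfolding w_def
      by (intro has_vector_derivative_within_subset[OF Ider[of t y]]) auto
    then have "(I y has_vector_derivative G (w t)) (at t)"
      using has_vector_derivative_within_open[OF t] by auto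
    then have "((\<lambda>t. y0 + (I y t - I y 0)) has_vector_derivative G (w t)) (at t)"
      by (auto intro!: derivative_eq_intros)
    then show ?thesis
      by (rule has_vector_derivative_transform_within_open[where S="{-h<..<h}"]) (use t weq in auto)
  qed
  have "continuous (at 0) w" unfolding w_def
    using continuous_on_apply_bcontfun[of UNIV y] continuous_on_eq_continuous_at open_UNIV by blast
  then obtain d where d: "d > 0" "\<And>t. dist t 0 < d \<Longrightarrow> dist (w t) y0 < r"
    using r w0 unfolding continuous_at_eps_delta by metis
  define k where "k = min h d"
  have k: "k > 0" using h d by (simp add: k_def)
  have "w t \<in> cball y0 r \<and> (w has_vector_derivative F (w t)) (at t)" if t: "t \<in> {-k<..<k}" for t
  proof -
    have "dist t 0 < d" using t by (auto simp: k_def dist_real_def)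
    then have 1: "w t \<in> cball y0 r" using d(2) by (simp add: dist_commute less_imp_le)
    have "(w has_vector_derivative G (w t)) (at t)" using wder t by (auto simp: k_def)
    then show ?thesis using 1 Pid by (simp add: G_def)
  qed
  then show ?thesis using k w0 by blast
qed

lemma smooth_on_lipschitz_cball:
  fixes u :: "real^'n \<Rightarrow> real"
  assumes "open S" "smooth_on S u" "cball x r \<subseteq> S"
  shows "\<exists>L. L-lipschitz_on (cball x r) u"
proof -
  have c: "continuous_on (cball x r) (\<lambda>y. \<Sum>k\<in>UNIV. \<bar>pd k u y\<bar>)"
  proof (intro continuous_intros)
    show "continuous_on (cball x r) (pd k u)" for k
      using assms(2,3) smooth_on_pd[of S u k] continuous_on_subset unfolding smooth_on_def
      by (metis Ck_on.simps(1))
  qed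
  obtain B where B: "\<bar>\<Sum>k\<in>UNIV. \<bar>pd k u y\<bar>\<bar> \<le> B" if "y \<in> cball x r" for y
    using compact_imp_bounded[OF compact_continuous_image[OF c compact_cball]]
    unfolding bounded_iff by (metis image_eqI real_norm_def)
  define M where "M = max B 0"
  have "norm (u y - u z) \<le> M * norm (y - z)" if "y \<in> cball x r" "z \<in> cball x r" for y z
  proof (rule differentiable_bound[OF convex_cball _ _ that])
    fix w assume w: "w \<in> cball x r"
    have "u differentiable (at w)" using w assms smooth_on_differentiable by blast
    from has_derivative_pd[OF this]
    show "(u has_derivative (\<lambda>v. \<Sum>k\<in>UNIV. v $ k * pd k u w)) (at w within cball x r)"
      by (rule has_derivative_at_withinI)
    show "onorm (\<lambda>v. \<Sum>k\<in>UNIV. v $ k * pd k u w) \<le> M"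
    proof (rule onorm_bound)
      fix v :: "real^'n"
      have "\<bar>\<Sum>k\<in>UNIV. v $ k * pd k u w\<bar> \<le> (\<Sum>k\<in>UNIV. \<bar>v $ k * pd k u w\<bar>)" by (rule sum_abs)
      also have "\<dots> \<le> (\<Sum>k\<in>UNIV. norm v * \<bar>pd k u w\<bar>)"
        by (intro sum_mono) (simp add: abs_mult component_le_norm_cart mult_right_mono)
      also have "\<dots> = (\<Sum>k\<in>UNIV. \<bar>pd k u w\<bar>) * norm v" by (simp add: sum_distrib_left mult.commute)
      also have "\<dots> \<le> M * norm v" using B[OF w] by (intro mult_right_mono) (auto simp: M_def)
      finally show "norm (\<Sum>k\<in>UNIV. v $ k * pd k u w) \<le> M * norm v" by simp
    qed (simp add: M_def)
  qed
  then have "M-lipschitz_on (cball x r) u" by (auto simp: lipschitz_on_def dist_norm M_def)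
  then show ?thesis by blast
qed

lemma lipschitz_on_mult_compact:
  fixes f g :: "'a::metric_space \<Rightarrow> real"
  assumes "compact K" "\<exists>L. L-lipschitz_on K f" "\<exists>L. L-lipschitz_on K g"
  shows "\<exists>L. L-lipschitz_on K (\<lambda>x. f x * g x)"
proof -
  obtain L M where L: "L-lipschitz_on K f" and M: "M-lipschitz_on K g" using assms by blast
  have "bounded (f ` K)" "bounded (g ` K)"
    using compact_imp_bounded[OF compact_continuous_image[OF _ assms(1)]]
      lipschitz_on_continuous_on[OF L] lipschitz_on_continuous_on[OF M] by auto
  then obtain A B where A0: "\<And>x. x \<in> K \<Longrightarrow> \<bar>f x\<bar> \<le> A" and B0: "\<And>x. x \<in> K \<Longrightarrow> \<bar>g x\<bar> \<le> B"
    unfolding bounded_iff by auto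
  define A' B' where "A' = max A 0" and "B' = max B 0"
  have A: "\<bar>f x\<bar> \<le> A'" and B: "\<bar>g x\<bar> \<le> B'" if "x \<in> K" for x
    using A0[OF that] B0[OF that] by (auto simp: A'_def B'_def)
  have pos: "0 \<le> A'" "0 \<le> B'" "0 \<le> L" "0 \<le> M"
    using lipschitz_on_nonneg[OF L] lipschitz_on_nonneg[OF M] by (auto simp: A'_def B'_def)
  have "(A' * M + B' * L)-lipschitz_on K (\<lambda>x. f x * g x)"
  proof (rule lipschitz_onI)
    fix x y assume xy: "x \<in> K" "y \<in> K"
    have "f x * g x - f y * g y = f x * (g x - g y) + g y * (f x - f y)" by (simp add: algebra_simps)
    then have "dist (f x * g x) (f y * g y) \<le> \<bar>f x\<bar> * dist (g x) (g y) + \<bar>g y\<bar> * dist (f x) (f y)"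
      unfolding dist_real_def by (metis abs_mult abs_triangle_ineq)
    also have "\<dots> \<le> A' * (M * dist x y) + B' * (L * dist x y)"
      using A[OF xy(1)] B[OF xy(2)] lipschitz_onD[OF L xy] lipschitz_onD[OF M xy] pos
      by (intro add_mono mult_mono) auto
    finally show "dist (f x * g x) (f y * g y) \<le> (A' * M + B' * L) * dist x y"
      by (simp add: algebra_simps)
  qed (use pos in auto)
  then show ?thesis by blast
qed

lemma lipschitz_on_sum:
  fixes f :: "'i \<Rightarrow> 'a::metric_space \<Rightarrow> 'b::real_normed_vector"
  assumes "\<And>i. i \<in> I \<Longrightarrow> \<exists>L. L-lipschitz_on K (f i)"
  shows "\<exists>L. L-lipschitz_on K (\<lambda>x. \<Sum>i\<in>I. f i x)"
  using assms
proof (induction I rule: infinite_finite_induct)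
  case (insert i I)
  then obtain L M where "L-lipschitz_on K (f i)" "M-lipschitz_on K (\<lambda>x. \<Sum>i\<in>I. f i x)" by blast
  from lipschitz_on_add[OF this] insert show ?case by auto
qed (auto intro: lipschitz_on_constant)

text \<open>The quadratic form $\Gamma^h_{jk} v^j v^k$ of the geodesic equation. Up to sign it is the
  acceleration of an affinely parametrised autoparallel curve with velocity \<open>v\<close>; it sees only the
  symmetric part of the coefficients.\<close>

definition spray :: "'n::finite coeffs \<Rightarrow> real^'n \<Rightarrow> real^'n \<Rightarrow> real^'n" where
  "spray C x v = (\<chi> h. \<Sum>j\<in>UNIV. \<Sum>k\<in>UNIV. C h j k x * v $ j * v $ k)"

text \<open>The geodesic equation is a first-order system for position and velocity. Its right-hand side is
  built from smooth coefficients and the velocity components by sums and products, hence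
  Lipschitz on a compact ball.\<close>

lemma autoparallel_exists:
  fixes C :: "'n::finite coeffs"
  assumes S: "open S" "x0 \<in> S" and sm: "\<And>h j k. smooth_on S (C h j k)" and v0: "v0 \<noteq> 0"
  shows "\<exists>h>0. \<exists>\<gamma> v. \<gamma> 0 = x0 \<and> v 0 = v0 \<and>
    (\<forall>t\<in>{-h<..<h}. \<gamma> t \<in> S \<and> v t \<noteq> 0 \<and> (\<gamma> has_vector_derivative v t) (at t) \<and>
       (v has_vector_derivative - spray C (\<gamma> t) (v t)) (at t))"
proof -
  obtain e where e: "e > 0" "cball x0 e \<subseteq> S" using S open_contains_cball by blast
  \<comment> \<open>The radius is smaller than the length of the initial velocity, so that the velocity cannot vanish inside the ball.\<close>
  define r where "r = min e (norm v0 / 2)"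
  have r: "r > 0" "r \<le> e" "r < norm v0" using e v0 by (auto simp: r_def min_def)
  define K where "K = cball (x0, v0) r"
  have Kc: "compact K" by (simp add: K_def)
  have K1: "fst z \<in> cball x0 e" and K2: "dist v0 (snd z) < norm v0" if "z \<in> K" for z
    using that r dist_fst_le[of "(x0, v0)" z] dist_snd_le[of "(x0, v0)" z] by (auto simp: K_def)
  have cmp: "\<exists>L. L-lipschitz_on K (\<lambda>z. C h j k (fst z))" for h j k
  proof -
    obtain L where L: "L-lipschitz_on (cball x0 e) (C h j k)"
      using smooth_on_lipschitz_cball[OF S(1) sm e(2)] by blast
    have "L-lipschitz_on K (\<lambda>z. C h j k (fst z))"
    proof (rule lipschitz_onI)
      fix x y assume xy: "x \<in> K" "y \<in> K"
      have "dist (C h j k (fst x)) (C h j k (fst y)) \<le> L * dist (fst x) (fst y)"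
        by (rule lipschitz_onD[OF L K1[OF xy(1)] K1[OF xy(2)]])
      also have "\<dots> \<le> L * dist x y"
        by (rule mult_left_mono[OF dist_fst_le lipschitz_on_nonneg[OF L]])
      finally show "dist (C h j k (fst x)) (C h j k (fst y)) \<le> L * dist x y" .
    qed (rule lipschitz_on_nonneg[OF L])
    then show ?thesis by blast
  qed
  have sndl: "\<exists>L. L-lipschitz_on K (\<lambda>z. snd z $ k)" for k :: 'n
  proof -
    have "1-lipschitz_on K (\<lambda>z. snd z $ k)"
    proof (rule lipschitz_onI)
      fix x y :: "(real^'n) \<times> (real^'n)"
      have "dist (snd x $ k) (snd y $ k) \<le> dist (snd x) (snd y)" by (rule dist_vec_nth_le)
      also have "\<dots> \<le> dist x y" by (rule dist_snd_le)
      finally show "dist (snd x $ k) (snd y $ k) \<le> 1 * dist x y" by simp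
    qed simp
    then show ?thesis by blast
  qed
  define F where "F z = (snd z, - spray C (fst z) (snd z))" for z
  have "\<exists>L. L-lipschitz_on K F"
  proof -
    have comp: "\<exists>L. L-lipschitz_on K (\<lambda>z. spray C (fst z) (snd z) $ h)" for h
      unfolding spray_def vec_lambda_beta
      by (intro lipschitz_on_sum lipschitz_on_mult_compact Kc cmp sndl)
    have "\<exists>L. L-lipschitz_on K (\<lambda>z. (spray C (fst z) (snd z) $ h) *\<^sub>R (axis h 1 :: real^'n))" for h
    proof -
      obtain L where L: "L-lipschitz_on K (\<lambda>z. spray C (fst z) (snd z) $ h)" using comp by blast
      have "L-lipschitz_on K (\<lambda>z. (spray C (fst z) (snd z) $ h) *\<^sub>R (axis h 1 :: real^'n))"
        using L by (auto simp: lipschitz_on_def dist_norm scaleR_diff_left[symmetric])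
      then show ?thesis by blast
    qed
    then have "\<exists>L. L-lipschitz_on K (\<lambda>z. \<Sum>h\<in>UNIV. (spray C (fst z) (snd z) $ h) *\<^sub>R (axis h 1 :: real^'n))"
      by (rule lipschitz_on_sum)
    then obtain L where L: "L-lipschitz_on K (\<lambda>z. spray C (fst z) (snd z))"
      by (auto simp: scalar_mult_eq_scaleR[symmetric] basis_expansion)
    have "1-lipschitz_on K (snd :: (real^'n) \<times> (real^'n) \<Rightarrow> _)" unfolding lipschitz_on_def using dist_snd_le by (metis mult_1 zero_le_one)
    from lipschitz_on_Pair[OF this lipschitz_on_minus[OF L]] show ?thesis unfolding F_def by blast
  qed
  then obtain L where "L-lipschitz_on (cball (x0, v0) r) F" by (auto simp: K_def)
  from picard_lindelof[OF r(1) this] obtain h y where h: "h > 0" and y0: "y 0 = (x0, v0)"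
    and y: "\<And>t. t \<in> {-h<..<h} \<Longrightarrow> y t \<in> K \<and> (y has_vector_derivative F (y t)) (at t)"
    unfolding K_def by blast
  have "fst (y t) \<in> S \<and> snd (y t) \<noteq> 0 \<and> ((\<lambda>t. fst (y t)) has_vector_derivative snd (y t)) (at t) \<and>
     ((\<lambda>t. snd (y t)) has_vector_derivative - spray C (fst (y t)) (snd (y t))) (at t)"
    if t: "t \<in> {-h<..<h}" for t
  proof -
    have "(y has_derivative (\<lambda>s. s *\<^sub>R F (y t))) (at t)" using y[OF t] by (simp add: has_vector_derivative_def)
    from has_derivative_fst[OF this] has_derivative_snd[OF this]
    have "((\<lambda>t. fst (y t)) has_vector_derivative snd (y t)) (at t)"
      "((\<lambda>t. snd (y t)) has_vector_derivative - spray C (fst (y t)) (snd (y t))) (at t)"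
      by (auto simp: has_vector_derivative_def F_def)
    moreover have "fst (y t) \<in> S" using K1 y[OF t] e by blast
    moreover have "snd (y t) \<noteq> 0" using K2[of "y t"] y[OF t] by auto
    ultimately show ?thesis by blast
  qed
  then show ?thesis using h y0
    by (intro exI[of _ h] conjI exI[of _ "\<lambda>t. fst (y t)"] exI[of _ "\<lambda>t. snd (y t)"]) auto
qed

section \<open>The Christoffel form of a metric\<close>

lemma has_derivative_vec:
  fixes f :: "'a::real_normed_vector \<Rightarrow> 'b::euclidean_space^'n"
  assumes "\<And>i. ((\<lambda>x. f x $ i) has_derivative (\<lambda>h. f' h $ i)) (at x)"
  shows "(f has_derivative f') (at x)"
proof -
  have "((\<lambda>x. f x \<bullet> b) has_derivative (\<lambda>h. f' h \<bullet> b)) (at x)" if b: "b \<in> Basis" for b :: "'b^'n"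
  proof -
    obtain i u where "b = axis i u" using b by (auto simp: Basis_vec_def)
    then show ?thesis using has_derivative_inner_left[OF assms[of i], of u] by (simp add: inner_axis)
  qed
  then show ?thesis using has_derivative_componentwise_within[of f f' x UNIV] by blast
qed

lemma has_derivative_matrix_vector_mult:
  fixes M :: "'a::real_normed_vector \<Rightarrow> real^'n^'m"
  assumes M: "(M has_derivative M') (at x)" and v: "(v has_derivative v') (at x)"
  shows "((\<lambda>y. M y *v v y) has_derivative (\<lambda>h. M x *v v' h + M' h *v v x)) (at x)"
proof (rule has_derivative_vec)
  fix i
  have e: "(B *v u) $ i = B $ i \<bullet> u" for B :: "real^'n^'m" and u
    by (simp add: matrix_vector_mult_def inner_vec_def)
  have "((\<lambda>y. M y $ i) has_derivative (\<lambda>h. M' h $ i)) (at x)"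
    using bounded_linear.has_derivative[OF bounded_linear_vec_nth M] .
  from has_derivative_inner[OF this v]
  show "((\<lambda>y. (M y *v v y) $ i) has_derivative (\<lambda>h. (M x *v v' h + M' h *v v x) $ i)) (at x)"
    by (simp add: e)
qed

definition bilin :: "real^'n^'n \<Rightarrow> real^'n \<Rightarrow> real^'n \<Rightarrow> real" where
  "bilin M v w = v \<bullet> (M *v w)"

text \<open>Working with the matrix of directional derivatives instead of its components replaces index
  manipulations in the transformation law by the product rule.\<close>

definition mat_dir_deriv :: "(real^'n \<Rightarrow> real^'n^'n) \<Rightarrow> real^'n \<Rightarrow> real^'n \<Rightarrow> real^'n^'n" where
  "mat_dir_deriv G x u = (\<chi> i j. \<Sum>k\<in>UNIV. u $ k * pd k (\<lambda>y. G y $ i $ j) x)"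

lemma bilin_add_left: "bilin M (u + v) w = bilin M u w + bilin M v w"
  by (simp add: bilin_def inner_add_left)

lemma bilin_add_right: "bilin M w (u + v) = bilin M w u + bilin M w v"
  by (simp add: bilin_def matrix_vector_right_distrib inner_add_right)

lemma bilin_sum: "bilin M v w = (\<Sum>i\<in>UNIV. \<Sum>j\<in>UNIV. v $ i * w $ j * M $ i $ j)"
  by (simp add: bilin_def inner_vec_def matrix_vector_mult_def sum_distrib_left mult_ac)

lemma has_derivative_mat_dir_deriv:
  fixes G :: "real^'n \<Rightarrow> real^'n^'n"
  assumes "\<And>i j. (\<lambda>y. G y $ i $ j) differentiable (at x)"
  shows "(G has_derivative mat_dir_deriv G x) (at x)"
  by (intro has_derivative_vec) (simp add: mat_dir_deriv_def has_derivative_pd[OF assms])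

lemma bilin_mat_dir_deriv:
  "bilin (mat_dir_deriv G x u) v w = (\<Sum>i\<in>UNIV. \<Sum>j\<in>UNIV. \<Sum>k\<in>UNIV. v $ i * w $ j * u $ k * pd k (\<lambda>y. G y $ i $ j) x)"
  by (simp add: bilin_sum mat_dir_deriv_def sum_distrib_left mult_ac)

lemma bilin_sym_part: "bilin (sym_part G x) v w = (bilin (G x) v w + bilin (G x) w v) / 2"
proof -
  have "bilin (G x) w v = (\<Sum>i\<in>UNIV. \<Sum>j\<in>UNIV. w $ j * v $ i * G x $ j $ i)"
    unfolding bilin_sum by (rule sum.swap)
  then have "bilin (G x) v w + bilin (G x) w v =
     (\<Sum>i\<in>UNIV. \<Sum>j\<in>UNIV. v $ i * w $ j * G x $ i $ j + w $ j * v $ i * G x $ j $ i)"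
    by (simp add: bilin_sum sum.distrib)
  also have "\<dots> = (\<Sum>i\<in>UNIV. \<Sum>j\<in>UNIV. 2 * (v $ i * w $ j * sym_part G x $ i $ j))"
    by (intro sum.cong refl) (simp add: sym_part_def field_simps)
  also have "\<dots> = 2 * bilin (sym_part G x) v w"
    by (simp add: bilin_sum sum_distrib_left)
  finally show ?thesis by simp
qed

lemma bilin_nondegenerate:
  fixes M :: "real^'n^'n"
  assumes "det M \<noteq> 0" "\<And>w. bilin M w a = bilin M w b"
  shows "a = b"
proof -
  have "w \<bullet> (M *v a) = w \<bullet> (M *v b)" for w using assms(2) by (simp add: bilin_def)
  then have "M *v a = M *v b" using vector_eq_ldot by blast
  then have "matrix_inv M *v (M *v a) = matrix_inv M *v (M *v b)" by simp
  then show ?thesis by (simp add: matrix_vector_mul_assoc matrix_inv_right_det[OF assms(1)])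
qed

text \<open>This is $\Gamma_{p.jk} w^p v^j v^k$ (see \<open>conn_low_contract\<close>), expressed through directional
  derivatives of the metric along \<open>v\<close> and \<open>w\<close>.\<close>

definition christoffel_form :: "(real^'n \<Rightarrow> real^'n^'n) \<Rightarrow> real^'n \<Rightarrow> real^'n \<Rightarrow> real^'n \<Rightarrow> real" where
  "christoffel_form G x v w = (bilin (mat_dir_deriv G x v) v w + bilin (mat_dir_deriv G x v) w v - bilin (mat_dir_deriv G x w) v v) / 2"

lemma conn_low_contract:
  "(\<Sum>p\<in>UNIV. w $ p * (\<Sum>j\<in>UNIV. \<Sum>k\<in>UNIV. conn_low G p j k x * v $ j * v $ k)) = christoffel_form G x v w"
proof -
  let ?g = "\<lambda>i j k. pd k (\<lambda>y. G y $ i $ j) x"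
  have 1: "bilin (mat_dir_deriv G x v) v w = (\<Sum>p\<in>UNIV. \<Sum>j\<in>UNIV. \<Sum>k\<in>UNIV. w $ p * v $ j * v $ k * ?g j p k)"
    unfolding bilin_mat_dir_deriv by (subst sum.swap) (simp add: mult_ac)
  have 2: "bilin (mat_dir_deriv G x v) w v = (\<Sum>p\<in>UNIV. \<Sum>j\<in>UNIV. \<Sum>k\<in>UNIV. w $ p * v $ j * v $ k * ?g p k j)"
    unfolding bilin_mat_dir_deriv by (rule sum.cong[OF refl], subst sum.swap) (simp add: mult_ac)
  have "bilin (mat_dir_deriv G x w) v v = (\<Sum>j\<in>UNIV. \<Sum>p\<in>UNIV. \<Sum>k\<in>UNIV. w $ p * v $ j * v $ k * ?g j k p)"
    unfolding bilin_mat_dir_deriv by (rule sum.cong[OF refl], subst sum.swap) (simp add: mult_ac)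
  also have "\<dots> = (\<Sum>p\<in>UNIV. \<Sum>j\<in>UNIV. \<Sum>k\<in>UNIV. w $ p * v $ j * v $ k * ?g j k p)"
    by (rule sum.swap)
  finally have 3: "bilin (mat_dir_deriv G x w) v v = (\<Sum>p\<in>UNIV. \<Sum>j\<in>UNIV. \<Sum>k\<in>UNIV. w $ p * v $ j * v $ k * ?g j k p)" .
  show ?thesis
    unfolding christoffel_form_def 1 2 3 sum.distrib[symmetric] sum_subtractf[symmetric] sum_divide_distrib sum_distrib_left
    by (intro sum.cong refl) (simp add: conn_low_def field_simps)
qed

text \<open>Raising the index is undone by pairing with the metric. As the symmetric part of the metric
  is nondegenerate, this identity for all \<open>w\<close> characterises \<open>spray (conn G) x v\<close>; inverse
  matrices do not occur in the transformation law.\<close>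

lemma sym_part_spray_conn:
  assumes "det (sym_part G x) \<noteq> 0"
  shows "bilin (sym_part G x) w (spray (conn G) x v) = christoffel_form G x v w"
proof -
  define q where "q = (\<chi> p. \<Sum>j\<in>UNIV. \<Sum>k\<in>UNIV. conn_low G p j k x * v $ j * v $ k)"
  have "spray (conn G) x v = matrix_inv (sym_part G x) *v q"
  proof (rule vec_eq_iff[THEN iffD2], rule allI)
    fix h
    have "spray (conn G) x v $ h = (\<Sum>j\<in>UNIV. \<Sum>k\<in>UNIV. \<Sum>p\<in>UNIV.
        sym_inv G x $ h $ p * (conn_low G p j k x * v $ j * v $ k))"
      by (simp add: spray_def conn_def sum_distrib_right mult.assoc)
    also have "\<dots> = (\<Sum>j\<in>UNIV. \<Sum>p\<in>UNIV. \<Sum>k\<in>UNIV.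
        sym_inv G x $ h $ p * (conn_low G p j k x * v $ j * v $ k))"
      by (rule sum.cong[OF refl], rule sum.swap)
    also have "\<dots> = (\<Sum>p\<in>UNIV. \<Sum>j\<in>UNIV. \<Sum>k\<in>UNIV.
        sym_inv G x $ h $ p * (conn_low G p j k x * v $ j * v $ k))"
      by (rule sum.swap)
    also have "\<dots> = (matrix_inv (sym_part G x) *v q) $ h"
      by (simp add: q_def matrix_vector_mult_def sum_distrib_left sym_inv_def)
    finally show "spray (conn G) x v $ h = (matrix_inv (sym_part G x) *v q) $ h" .
  qed
  then have "sym_part G x *v spray (conn G) x v = q"
    by (simp add: matrix_vector_mul_assoc matrix_inv_right_det[OF assms])
  then show ?thesis
    unfolding bilin_def using conn_low_contract[of w G x v] by (simp add: q_def inner_vec_def)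
qed

section \<open>Charts and transition maps\<close>

lemma chart_facts:
  fixes c :: "('a, 'n::finite) chart"
  assumes "is_chart X c"
  shows chart_inj: "inj_on (snd c) (fst c)"
    and chart_open_dom: "open (coord_dom c)"
    and chart_dom_subset: "fst c \<subseteq> topspace X"
    and chart_openin: "openin X (fst c)"
    and chart_homeo: "homeomorphic_map (subtopology X (fst c)) (top_of_set (coord_dom c)) (snd c)"
proof -
  show o: "openin X (fst c)" and "open (coord_dom c)"
    and h: "homeomorphic_map (subtopology X (fst c)) (top_of_set (coord_dom c)) (snd c)"
    using assms by (auto simp: is_chart_def)
  show s: "fst c \<subseteq> topspace X" using o by (rule openin_subset)
  have "topspace (subtopology X (fst c)) = fst c" using s by auto
  then show "inj_on (snd c) (fst c)" using homeomorphic_imp_injective_map[OF h] by simp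
qed

lemma chart_inv_in: "x \<in> coord_dom c \<Longrightarrow> chart_inv c x \<in> fst c"
  unfolding coord_dom_def chart_inv_def by (rule inv_into_into)

lemma chart_chart_inv: "x \<in> coord_dom c \<Longrightarrow> snd c (chart_inv c x) = x"
  unfolding coord_dom_def chart_inv_def by (rule f_inv_into_f)

lemma chart_inv_chart: "is_chart X c \<Longrightarrow> p \<in> fst c \<Longrightarrow> chart_inv c (snd c p) = p"
  unfolding chart_inv_def using chart_inj by (metis inv_into_f_f)

lemma chart_image_open:
  fixes c :: "('a, 'n::finite) chart"
  assumes "is_chart X c" "openin X V"
  shows "open (snd c ` (fst c \<inter> V))"
proof -
  have "openin (subtopology X (fst c)) (fst c \<inter> V)"
    using assms(2) by (metis inf_commute openin_subtopology_Int)
  then have "openin (top_of_set (coord_dom c)) (snd c ` (fst c \<inter> V))"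
    using homeomorphic_imp_open_map[OF chart_homeo[OF assms(1)]] unfolding open_map_def by blast
  then show ?thesis using chart_open_dom[OF assms(1)] openin_open_trans by blast
qed

lemma chart_inv_continuous:
  fixes c :: "('a, 'n::finite) chart"
  assumes "is_chart X c"
  shows "continuous_map (top_of_set (coord_dom c)) X (chart_inv c)"
proof -
  obtain k where k: "homeomorphic_maps (subtopology X (fst c)) (top_of_set (coord_dom c)) (snd c) k"
    using chart_homeo[OF assms] homeomorphic_map_maps by blast
  have "continuous_map (top_of_set (coord_dom c)) (subtopology X (fst c)) (chart_inv c)"
  proof (rule continuous_map_eq)
    show "continuous_map (top_of_set (coord_dom c)) (subtopology X (fst c)) k"
      using k unfolding homeomorphic_maps_def by blast
    fix x assume "x \<in> topspace (top_of_set (coord_dom c))"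
    then have x: "x \<in> coord_dom c" by simp
    have "chart_inv c x \<in> topspace (subtopology X (fst c))"
      using chart_inv_in[OF x] chart_dom_subset[OF assms] by auto
    then have "k (snd c (chart_inv c x)) = chart_inv c x" using k unfolding homeomorphic_maps_def by blast
    then show "k x = chart_inv c x" using chart_chart_inv[OF x] by simp
  qed
  then show ?thesis by (simp add: continuous_map_in_subtopology)
qed

lemma overlap_open:
  fixes c d :: "('a, 'n::finite) chart"
  shows "is_chart X c \<Longrightarrow> is_chart X d \<Longrightarrow> open (overlap c d)"
  unfolding overlap_def using chart_image_open chart_openin by blast

lemma overlap_subset: "overlap c d \<subseteq> coord_dom c"
  unfolding overlap_def coord_dom_def by blast

lemma overlap_iff:
  assumes "is_chart X c"
  shows "x \<in> overlap c d \<longleftrightarrow> x \<in> coord_dom c \<and> chart_inv c x \<in> fst d"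
proof
  assume "x \<in> overlap c d"
  then obtain p where p: "p \<in> fst c" "p \<in> fst d" "x = snd c p" by (auto simp: overlap_def)
  then show "x \<in> coord_dom c \<and> chart_inv c x \<in> fst d"
    using chart_inv_chart[OF assms p(1)] by (auto simp: coord_dom_def)
next
  assume "x \<in> coord_dom c \<and> chart_inv c x \<in> fst d"
  then show "x \<in> overlap c d"
    using chart_inv_in[of x c] chart_chart_inv[of x c] unfolding overlap_def
    by (metis IntI image_eqI)
qed

lemma trans_map_overlap:
  assumes "is_chart X c" "is_chart X d" "x \<in> overlap c d"
  shows "trans_map c d x \<in> overlap d c" "trans_map d c (trans_map c d x) = x"
proof -
  obtain p where p: "p \<in> fst c" "p \<in> fst d" "x = snd c p" using assms(3) by (auto simp: overlap_def)
  then have t: "trans_map c d x = snd d p"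
    using chart_inv_chart[OF assms(1) p(1)] by (simp add: trans_map_def)
  then show "trans_map c d x \<in> overlap d c" using p by (auto simp: overlap_def)
  show "trans_map d c (trans_map c d x) = x"
    using t chart_inv_chart[OF assms(2) p(2)] p(3) by (simp add: trans_map_def)
qed

definition jac_mat :: "('a, 'n::finite) chart \<Rightarrow> ('a, 'n) chart \<Rightarrow> real^'n \<Rightarrow> real^'n^'n" where
  "jac_mat c d x = (\<chi> a i. jac c d x a i)"

lemma atlas_chart: "smooth_manifold X A \<Longrightarrow> c \<in> A \<Longrightarrow> is_chart X c"
  by (auto simp: smooth_manifold_def)

lemma atlas_smooth:
  assumes "smooth_manifold X A" "c \<in> A" "d \<in> A"
  shows "smooth_on (overlap c d) (\<lambda>y. trans_map c d y $ a)"
  using assms by (auto simp: smooth_manifold_def compatible_def smooth_vec_on_def)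

lemma atlas_smooth_jac:
  assumes "smooth_manifold X A" "c \<in> A" "d \<in> A"
  shows "smooth_on (overlap c d) (\<lambda>y. jac c d y a i)"
  unfolding jac_def using smooth_on_pd[OF atlas_smooth[OF assms, of a], of i] by simp

lemma trans_map_has_derivative:
  fixes c d :: "('a, 'n::finite) chart"
  assumes M: "smooth_manifold X A" "c \<in> A" "d \<in> A" and x: "x \<in> overlap c d"
  shows "(trans_map c d has_derivative (\<lambda>v. jac_mat c d x *v v)) (at x)"
proof (rule has_derivative_vec)
  fix a
  have "(\<lambda>y. trans_map c d y $ a) differentiable (at x)"
    using smooth_on_differentiable[OF overlap_open atlas_smooth[OF M] x] atlas_chart M by blast
  from has_derivative_pd[OF this]
  show "((\<lambda>y. trans_map c d y $ a) has_derivative (\<lambda>v. (jac_mat c d x *v v) $ a)) (at x)"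
    by (simp add: jac_mat_def jac_def matrix_vector_mult_def mult.commute)
qed

lemma jac_mat_inverse:
  fixes c d :: "('a, 'n::finite) chart"
  assumes M: "smooth_manifold X A" "c \<in> A" "d \<in> A" and x: "x \<in> overlap c d"
  shows "jac_mat d c (trans_map c d x) *v (jac_mat c d x *v v) = v"
proof -
  note ch = atlas_chart[OF M(1,2)] atlas_chart[OF M(1,3)]
  have "((\<lambda>y. trans_map d c (trans_map c d y)) has_derivative
      (\<lambda>v. jac_mat d c (trans_map c d x) *v (jac_mat c d x *v v))) (at x)"
    by (rule has_derivative_compose[OF trans_map_has_derivative[OF M x]
       trans_map_has_derivative[OF M(1,3,2) trans_map_overlap(1)[OF ch x]]])
  moreover have "((\<lambda>y. trans_map d c (trans_map c d y)) has_derivative (\<lambda>v. v)) (at x)"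
    by (rule has_derivative_transform_within_open[OF has_derivative_ident overlap_open[OF ch] x])
      (simp add: trans_map_overlap(2)[OF ch])
  ultimately have "(\<lambda>v. jac_mat d c (trans_map c d x) *v (jac_mat c d x *v v)) = (\<lambda>v. v)"
    by (rule has_derivative_unique)
  then show ?thesis by metis
qed

lemma jac_mat_has_derivative:
  fixes c d :: "('a, 'n::finite) chart"
  assumes M: "smooth_manifold X A" "c \<in> A" "d \<in> A" and x: "x \<in> overlap c d"
  shows "(jac_mat c d has_derivative mat_dir_deriv (jac_mat c d) x) (at x)"
proof (rule has_derivative_mat_dir_deriv)
  have "open (overlap c d)" using overlap_open atlas_chart M by blast
  from smooth_on_differentiable[OF this atlas_smooth_jac[OF M] x]
  show "(\<lambda>y. jac_mat c d y $ i $ j) differentiable at x" for i j by (simp add: jac_mat_def)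
qed

text \<open>Both sides are second derivatives of the transition map, taken along \<open>u\<close> and \<open>v\<close> in either order.\<close>

lemma mat_dir_deriv_jac_mat_sym:
  fixes c d :: "('a, 'n::finite) chart"
  assumes M: "smooth_manifold X A" "c \<in> A" "d \<in> A" and x: "x \<in> overlap c d"
  shows "mat_dir_deriv (jac_mat c d) x u *v v = mat_dir_deriv (jac_mat c d) x v *v u"
proof (rule vec_eq_iff[THEN iffD2], rule allI)
  fix a
  let ?H = "\<lambda>i k. pd k (\<lambda>y. jac c d y a i) x"
  have op: "open (overlap c d)" using overlap_open atlas_chart M by blast
  have sym: "?H i k = ?H k i" for i k
    using pd_commute[OF op atlas_smooth[OF M] x, of k i a] unfolding jac_def by simp
  have e: "(mat_dir_deriv (jac_mat c d) x u *v v) $ a = (\<Sum>i\<in>UNIV. \<Sum>k\<in>UNIV. u $ k * v $ i * ?H i k)" for u v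
    by (simp add: mat_dir_deriv_def jac_mat_def matrix_vector_mult_def sum_distrib_left mult_ac)
  have "(\<Sum>i\<in>UNIV. \<Sum>k\<in>UNIV. u $ k * v $ i * ?H i k) = (\<Sum>k\<in>UNIV. \<Sum>i\<in>UNIV. u $ k * v $ i * ?H i k)"
    by (rule sum.swap)
  also have "\<dots> = (\<Sum>k\<in>UNIV. \<Sum>i\<in>UNIV. v $ i * u $ k * ?H k i)"
    by (intro sum.cong refl) (simp add: sym mult_ac)
  finally show "(mat_dir_deriv (jac_mat c d) x u *v v) $ a = (mat_dir_deriv (jac_mat c d) x v *v u) $ a"
    unfolding e .
qed

section \<open>Transformation of the connection\<close>

lemma tensor02_bilin:
  assumes "tensor02_field A G" "c \<in> A" "d \<in> A" "x \<in> overlap c d"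
  shows "bilin (G c x) v w = bilin (G d (trans_map c d x)) (jac_mat c d x *v v) (jac_mat c d x *v w)"
proof -
  let ?J = "jac_mat c d x" and ?N = "G d (trans_map c d x)"
  have law: "G c x $ i $ j = (\<Sum>a\<in>UNIV. \<Sum>b\<in>UNIV. jac c d x a i * jac c d x b j * ?N $ a $ b)" for i j
    using assms by (auto simp: tensor02_field_def)
  have "G c x = transpose ?J ** (?N ** ?J)"
    by (simp add: vec_eq_iff law matrix_matrix_mult_def transpose_def jac_mat_def sum_distrib_left mult_ac)
  then have "bilin (G c x) v w = v \<bullet> (transpose ?J *v (?N *v (?J *v w)))"
    by (simp add: bilin_def matrix_vector_mul_assoc matrix_mul_assoc)
  also have "\<dots> = (?J *v v) \<bullet> (?N *v (?J *v w))"
    by (metis dot_lmul_matrix inner_commute transpose_matrix_vector)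
  finally show ?thesis by (simp add: bilin_def)
qed

lemma tensor02_differentiable:
  assumes "smooth_manifold X A" "tensor02_field A G" "c \<in> A" "x \<in> coord_dom c"
  shows "(\<lambda>y. G c y $ i $ j) differentiable (at x)"
  using assms smooth_on_differentiable[OF chart_open_dom] atlas_chart[OF assms(1,3)]
  unfolding tensor02_field_def by blast

text \<open>Differentiating $g(v,w) = g'(Jv, Jw)$ along a third vector by the product rule produces, besides
  the derivative of $g'$, terms containing the second derivative of the transition map. By its
  symmetry these cancel in the Christoffel combination, up to the one that pairs with \<open>jac_mat c d x *v w\<close>.\<close>

lemma christoffel_form_transform:
  fixes c d :: "('a, 'n::finite) chart"
  assumes M: "smooth_manifold X A" "c \<in> A" "d \<in> A" and x: "x \<in> overlap c d" and G: "tensor02_field A G"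
  shows "christoffel_form (G c) x v w =
     bilin (sym_part (G d) (trans_map c d x)) (jac_mat c d x *v w) (mat_dir_deriv (jac_mat c d) x v *v v)
     + christoffel_form (G d) (trans_map c d x) (jac_mat c d x *v v) (jac_mat c d x *v w)"
proof -
  note ch = atlas_chart[OF M(1,2)] atlas_chart[OF M(1,3)]
  let ?T = "trans_map c d" and ?J = "jac_mat c d"
  let ?H = "\<lambda>u v. mat_dir_deriv ?J x u *v v" and ?N = "G d (?T x)"
  have dN: "(G d has_derivative mat_dir_deriv (G d) (?T x)) (at (?T x))"
    using has_derivative_mat_dir_deriv tensor02_differentiable[OF M(1) G M(3)] trans_map_overlap(1)[OF ch x] overlap_subset
    by blast
  have dGT: "((\<lambda>y. G d (?T y)) has_derivative (\<lambda>u. mat_dir_deriv (G d) (?T x) (?J x *v u))) (at x)"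
    by (rule has_derivative_compose[OF trans_map_has_derivative[OF M x] dN])
  have dJ: "((\<lambda>y. ?J y *v a) has_derivative (\<lambda>u. ?H u a)) (at x)" for a
    using has_derivative_matrix_vector_mult[OF jac_mat_has_derivative[OF M x] has_derivative_const[of a]]
    by simp
  have dc: "(G c has_derivative mat_dir_deriv (G c) x) (at x)"
    using has_derivative_mat_dir_deriv tensor02_differentiable[OF M(1) G M(2)] x overlap_subset by blast
  have key: "bilin (mat_dir_deriv (G c) x u) a b = bilin ?N (?H u a) (?J x *v b) + bilin ?N (?J x *v a) (?H u b)
      + bilin (mat_dir_deriv (G d) (?T x) (?J x *v u)) (?J x *v a) (?J x *v b)" for u a b
  proof -
    have "((\<lambda>y. bilin (G c y) a b) has_derivative (\<lambda>u. bilin (mat_dir_deriv (G c) x u) a b)) (at x)"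
      unfolding bilin_def
      using has_derivative_inner_right[OF has_derivative_matrix_vector_mult[OF dc has_derivative_const[of b]], of a]
      by simp
    moreover have "((\<lambda>y. bilin (G c y) a b) has_derivative (\<lambda>u. (?J x *v a) \<bullet>
        (?N *v ?H u b + mat_dir_deriv (G d) (?T x) (?J x *v u) *v (?J x *v b)) + ?H u a \<bullet> (?N *v (?J x *v b)))) (at x)"
    proof (rule has_derivative_transform_within_open[OF _ overlap_open[OF ch] x])
      show "((\<lambda>y. (?J y *v a) \<bullet> (G d (?T y) *v (?J y *v b))) has_derivative (\<lambda>u. (?J x *v a) \<bullet>
        (?N *v ?H u b + mat_dir_deriv (G d) (?T x) (?J x *v u) *v (?J x *v b)) + ?H u a \<bullet> (?N *v (?J x *v b)))) (at x)"
        by (rule has_derivative_inner[OF dJ has_derivative_matrix_vector_mult[OF dGT dJ]])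
      show "(?J y *v a) \<bullet> (G d (?T y) *v (?J y *v b)) = bilin (G c y) a b" if "y \<in> overlap c d" for y
        using tensor02_bilin[OF G M(2,3) that] by (simp add: bilin_def)
    qed
    ultimately have "(\<lambda>u. bilin (mat_dir_deriv (G c) x u) a b) = (\<lambda>u. (?J x *v a) \<bullet>
        (?N *v ?H u b + mat_dir_deriv (G d) (?T x) (?J x *v u) *v (?J x *v b)) + ?H u a \<bullet> (?N *v (?J x *v b)))"
      by (rule has_derivative_unique)
    from fun_cong[OF this, of u] show ?thesis by (simp add: bilin_def inner_add_right)
  qed
  have sym: "?H w v = ?H v w" by (rule mat_dir_deriv_jac_mat_sym[OF M x])
  \<comment> \<open>The cancellation takes place in the terms denoted \<open>q\<close> and \<open>s\<close>.\<close>
  have "(p + q + r + (s + t + y) - (s + q + z)) / 2 = (t + p) / 2 + (r + y - z) / 2"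
    for p q r s t y z :: real by (simp add: field_simps)
  then show ?thesis unfolding christoffel_form_def key bilin_sym_part sym .
qed

lemma tensor02_sym_bilin:
  assumes "tensor02_field A G" "c \<in> A" "d \<in> A" "x \<in> overlap c d"
  shows "bilin (sym_part (G c) x) v w
     = bilin (sym_part (G d) (trans_map c d x)) (jac_mat c d x *v v) (jac_mat c d x *v w)"
  unfolding bilin_sym_part using tensor02_bilin[OF assms] by simp

text \<open>The classical inhomogeneous transformation law, contracted with $v^j v^k$. The inhomogeneous
  term depends only on the charts, and not on the metric.\<close>

lemma spray_conn_transform:
  fixes c d :: "('a, 'n::finite) chart"
  assumes GR: "gen_riemannian X A G" and cd: "c \<in> A" "d \<in> A" and x: "x \<in> overlap c d"
  shows "jac_mat c d x *v spray (conn (G c)) x v =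
     mat_dir_deriv (jac_mat c d) x v *v v + spray (conn (G d)) (trans_map c d x) (jac_mat c d x *v v)"
proof -
  have M: "smooth_manifold X A" and G: "tensor02_field A G"
    and nz: "\<And>c x. c \<in> A \<Longrightarrow> x \<in> coord_dom c \<Longrightarrow> det (sym_part (G c) x) \<noteq> 0"
    using GR by (auto simp: gen_riemannian_def)
  note ch = atlas_chart[OF M cd(1)] atlas_chart[OF M cd(2)]
  let ?T = "trans_map c d" and ?J = "jac_mat c d"
  have Tx: "?T x \<in> overlap d c" by (rule trans_map_overlap(1)[OF ch x])
  have nzd: "det (sym_part (G d) (?T x)) \<noteq> 0" using nz[OF cd(2)] Tx overlap_subset by blast
  have nzc: "det (sym_part (G c) x) \<noteq> 0" using nz[OF cd(1)] x overlap_subset by blast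
  show ?thesis
  proof (rule bilin_nondegenerate[OF nzd])
    fix w'
    define w where "w = jac_mat d c (?T x) *v w'"
    have w: "?J x *v w = w'"
      using jac_mat_inverse[OF M cd(2,1) Tx, of w'] trans_map_overlap(2)[OF ch x] by (simp add: w_def)
    have "bilin (sym_part (G d) (?T x)) w' (?J x *v spray (conn (G c)) x v)
        = bilin (sym_part (G c) x) w (spray (conn (G c)) x v)"
      using tensor02_sym_bilin[OF G cd x] w by simp
    also have "\<dots> = christoffel_form (G c) x v w" by (rule sym_part_spray_conn[OF nzc])
    also have "\<dots> = bilin (sym_part (G d) (?T x)) w' (mat_dir_deriv ?J x v *v v) + christoffel_form (G d) (?T x) (?J x *v v) w'"
      using christoffel_form_transform[OF M cd x G] w by simp
    also have "\<dots> = bilin (sym_part (G d) (?T x)) w' (mat_dir_deriv ?J x v *v v + spray (conn (G d)) (?T x) (?J x *v v))"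
      using sym_part_spray_conn[OF nzd] by (simp add: bilin_add_right)
    finally show "bilin (sym_part (G d) (?T x)) w' (?J x *v spray (conn (G c)) x v) =
       bilin (sym_part (G d) (?T x)) w' (mat_dir_deriv ?J x v *v v + spray (conn (G d)) (?T x) (?J x *v v))" .
  qed
qed

section \<open>Connections with the same autoparallel curves\<close>

lemma sum_kron: "(\<Sum>p\<in>UNIV. kron p i * f p) = (f i :: real)" "(\<Sum>p\<in>UNIV. kron i p * f p) = (f i :: real)"
  "(\<Sum>p\<in>UNIV. f p * kron p i) = (f i :: real)" "(\<Sum>p\<in>UNIV. f p * kron i p) = (f i :: real)"
  for i :: "'n::finite"
proof -
  have "(\<Sum>p\<in>UNIV. kron p i * f p) = (\<Sum>p\<in>UNIV. if p = i then f p else 0)"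
    by (intro sum.cong) (auto simp: kron_def)
  then show 1: "(\<Sum>p\<in>UNIV. kron p i * f p) = f i" by simp
  have k: "kron i p = kron p i" for p by (simp add: kron_def)
  show "(\<Sum>p\<in>UNIV. kron i p * f p) = (f i :: real)"
    "(\<Sum>p\<in>UNIV. f p * kron p i) = (f i :: real)" "(\<Sum>p\<in>UNIV. f p * kron i p) = (f i :: real)"
    using 1 by (simp_all add: k mult.commute)
qed

lemma bilin_axis: "bilin M (axis i 1) (axis j 1) = M $ i $ j"
  by (simp add: bilin_def matrix_vector_mult_basis column_def inner_axis' )

lemma bilin_minus_left: "bilin M (- v) w = - bilin M v w"
  by (simp add: bilin_def)

lemma bilin_minus_right: "bilin M v (- w) = - bilin M v w"
  using bilin_add_right[of M v w "- w"] by (simp add: bilin_def)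

text \<open>A quadratic map whose value at each \<open>v\<close> is a multiple of \<open>v\<close> has a factor that is linear
  in \<open>v\<close>. Evaluation at the basis vectors and at the sums of two of them kills all components
  with \<open>h\<close> different from \<open>j\<close> and \<open>k\<close>; comparing sums with differences identifies
  \<open>P k j k\<close> with half of \<open>P j j j\<close>.\<close>

lemma projective_algebra:
  fixes P :: "'n::finite \<Rightarrow> 'n \<Rightarrow> 'n \<Rightarrow> real"
  assumes sym: "\<And>h j k. P h j k = P h k j"
    and par: "\<And>v :: real^'n. v \<noteq> 0 \<Longrightarrow> \<exists>\<rho>. \<forall>h. (\<Sum>j\<in>UNIV. \<Sum>k\<in>UNIV. P h j k * v $ j * v $ k) = \<rho> * v $ h"
  shows "\<exists>\<psi>. \<forall>h j k. P h j k = kron h j * \<psi> k + kron h k * \<psi> j"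
proof -
  define M where "M h = (\<chi> j k. P h j k)" for h
  have q: "(\<Sum>j\<in>UNIV. \<Sum>k\<in>UNIV. P h j k * v $ j * v $ k) = bilin (M h) v v" for h v
    by (simp add: bilin_sum M_def mult_ac)
  have par': "\<exists>\<rho>. \<forall>h. bilin (M h) v v = \<rho> * v $ h" if "v \<noteq> 0" for v
    using par[OF that] unfolding q .
  have one: "P h j j = 0" if "h \<noteq> j" for h j
  proof -
    have "axis j (1::real) \<noteq> 0" by (simp add: axis_eq_0_iff)
    from par'[OF this] obtain \<rho> where "\<forall>h. P h j j = \<rho> * axis j 1 $ h" by (auto simp: bilin_axis M_def)
    then show ?thesis using that by (simp add: axis_def)
  qed
  have plus: "\<exists>\<rho>. \<forall>h. P h j j + 2 * P h j k + P h k k = \<rho> * (axis j 1 + axis k 1) $ h" if "j \<noteq> k" for j k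
  proof -
    have "(axis j 1 + axis k 1 :: real^'n) $ j \<noteq> 0" using that by (simp add: axis_def)
    then have "axis j 1 + axis k (1::real) \<noteq> 0" by (metis zero_index)
    from par'[OF this] obtain \<rho> where \<rho>:
      "\<forall>h. bilin (M h) (axis j 1 + axis k 1) (axis j 1 + axis k 1) = \<rho> * (axis j 1 + axis k 1) $ h" by blast
    have bm: "bilin (M h) (axis j 1 + axis k 1) (axis j 1 + axis k 1) = P h j j + 2 * P h j k + P h k k" for h
      using sym[of h k j] by (simp add: bilin_add_left bilin_add_right bilin_axis M_def)
    show ?thesis using \<rho> unfolding bm by blast
  qed
  have minus: "\<exists>\<rho>. \<forall>h. P h j j - 2 * P h j k + P h k k = \<rho> * (axis j 1 + - axis k 1) $ h" if "j \<noteq> k" for j k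
  proof -
    have "(axis j 1 + - axis k 1 :: real^'n) $ j \<noteq> 0" using that by (simp add: axis_def)
    then have "axis j 1 + - axis k (1::real) \<noteq> 0" by (metis zero_index)
    from par'[OF this] obtain \<rho> where \<rho>:
      "\<forall>h. bilin (M h) (axis j 1 + - axis k 1) (axis j 1 + - axis k 1) = \<rho> * (axis j 1 + - axis k 1) $ h" by blast
    have bm: "bilin (M h) (axis j 1 + - axis k 1) (axis j 1 + - axis k 1) = P h j j - 2 * P h j k + P h k k" for h
      using sym[of h k j] by (simp add: bilin_add_left bilin_add_right bilin_minus_left bilin_minus_right bilin_axis M_def del: add_uminus_conv_diff)
    show ?thesis using \<rho> unfolding bm by blast
  qed
  define \<psi> where "\<psi> j = P j j j / 2" for j
  have three: "P h j k = 0" if ne: "j \<noteq> k" "h \<noteq> j" "h \<noteq> k" for h j k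
  proof -
    obtain \<rho> where "\<And>h. P h j j + 2 * P h j k + P h k k = \<rho> * (axis j 1 + axis k 1) $ h"
      using plus[OF ne(1)] by blast
    from this[of h] show ?thesis using one[OF ne(2)] one[OF ne(3)] ne by (simp add: axis_def)
  qed
  have two: "P k j k = \<psi> j" if jk: "j \<noteq> k" for j k
  proof -
    obtain \<rho> where \<rho>: "\<And>h. P h j j + 2 * P h j k + P h k k = \<rho> * (axis j 1 + axis k 1) $ h" using plus[OF jk] by blast
    obtain \<sigma> where \<sigma>: "\<And>h. P h j j - 2 * P h j k + P h k k = \<sigma> * (axis j 1 + - axis k 1) $ h" using minus[OF jk] by blast
    have "P j j j + 2 * P j j k = \<rho>" "2 * P k j k + P k k k = \<rho>"
      using \<rho>[of j] \<rho>[of k] one[of j k] one[of k j] jk by (simp_all add: axis_def)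
    moreover have "P j j j - 2 * P j j k = \<sigma>" "- 2 * P k j k + P k k k = - \<sigma>"
      using \<sigma>[of j] \<sigma>[of k] one[of j k] one[of k j] jk by (simp_all add: axis_def)
    ultimately show ?thesis unfolding \<psi>_def by linarith
  qed
  have "P h j k = kron h j * \<psi> k + kron h k * \<psi> j" for h j k
  proof (cases "j = k")
    case True
    then show ?thesis using one[of h j] by (cases "h = j") (simp_all add: kron_def \<psi>_def)
  next
    case False
    then show ?thesis
      using three[OF False, of h] two[OF False] two[of k j] sym[of j j k]
      by (cases "h = j"; cases "h = k") (simp_all add: kron_def)
  qed
  then show ?thesis by blast
qed

definition proj_related :: "'n::finite coeffs \<Rightarrow> 'n coeffs \<Rightarrow> real^'n \<Rightarrow> real^'n \<Rightarrow> bool" where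
  "proj_related C Cb x w \<longleftrightarrow>
     (\<forall>h j k. Cb h j k x - C h j k x = kron h j * w $ k + kron h k * w $ j)"

text \<open>Contracting the relation over one index multiplies the covector by $N + 1$.\<close>

lemma proj_related_covector:
  fixes w :: "real^'n::finite"
  assumes "proj_related C Cb x w"
  shows "(\<chi> i. (\<Sum>a\<in>UNIV. Cb a i a x - C a i a x) / (real CARD('n) + 1)) = w"
proof (rule vec_eq_iff[THEN iffD2], rule allI)
  fix i
  have "(\<Sum>a\<in>UNIV. Cb a i a x - C a i a x) = (\<Sum>a\<in>UNIV. kron a i * w $ a + w $ i)"
    using assms by (intro sum.cong) (auto simp: proj_related_def kron_def)
  also have "\<dots> = (real CARD('n) + 1) * w $ i"
    by (simp add: sum.distrib sum_kron algebra_simps)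
  finally show "(\<chi> i. (\<Sum>a\<in>UNIV. Cb a i a x - C a i a x) / (real CARD('n) + 1)) $ i = w $ i"
    by (simp add: add_eq_0_iff2 field_simps)
qed

text \<open>The two Kronecker terms contribute equally, so the difference is tangent to the curve. This is
  what makes projectively related connections share their unparametrised autoparallel curves.\<close>

lemma proj_related_spray:
  assumes "proj_related C Cb x w"
  shows "spray Cb x v = spray C x v + (2 * (w \<bullet> v)) *\<^sub>R v"
proof (rule vec_eq_iff[THEN iffD2], rule allI)
  fix h
  have "spray Cb x v $ h - spray C x v $ h = (\<Sum>j\<in>UNIV. \<Sum>k\<in>UNIV. (Cb h j k x - C h j k x) * v $ j * v $ k)"
    by (simp add: spray_def sum_subtractf left_diff_distrib)
  also have "\<dots> = (\<Sum>j\<in>UNIV. \<Sum>k\<in>UNIV. kron h j * (w $ k * v $ j * v $ k) + kron h k * (w $ j * v $ j * v $ k))"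
    using assms by (simp add: proj_related_def algebra_simps)
  also have "\<dots> = (\<Sum>k\<in>UNIV. w $ k * v $ h * v $ k) + (\<Sum>j\<in>UNIV. w $ j * v $ j * v $ h)"
    by (simp add: sum.distrib sum_kron sum_distrib_left[symmetric])
  also have "\<dots> = 2 * (w \<bullet> v) * v $ h"
    by (simp add: inner_vec_def sum_distrib_left sum_distrib_right sum.distrib[symmetric] mult_ac)
  finally show "spray Cb x v $ h = (spray C x v + (2 * (w \<bullet> v)) *\<^sub>R v) $ h" by simp
qed

lemma proj_relatedI:
  fixes C Cb :: "'n::finite coeffs"
  assumes tors: "\<And>h j k. torsion Cb h j k x = torsion C h j k x"
    and par: "\<And>v. v \<noteq> 0 \<Longrightarrow> \<exists>\<rho>. spray Cb x v - spray C x v = \<rho> *\<^sub>R v"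
  shows "\<exists>w. proj_related C Cb x w"
proof -
  let ?P = "\<lambda>h j k. Cb h j k x - C h j k x"
  have "\<exists>\<rho>. \<forall>h. (\<Sum>j\<in>UNIV. \<Sum>k\<in>UNIV. ?P h j k * v $ j * v $ k) = \<rho> * v $ h" if v: "v \<noteq> 0" for v
  proof -
    obtain \<rho> where \<rho>: "spray Cb x v - spray C x v = \<rho> *\<^sub>R v" using par[OF v] by blast
    have "spray Cb x v $ h - spray C x v $ h = \<rho> * v $ h" for h
      using arg_cong[OF \<rho>, of "\<lambda>u. u $ h"] by simp
    then show ?thesis by (auto simp: spray_def sum_subtractf left_diff_distrib)
  qed
  moreover have "?P h j k = ?P h k j" for h j k using tors[of h j k] by (simp add: torsion_def)
  ultimately obtain \<psi> where "\<forall>h j k. ?P h j k = kron h j * \<psi> k + kron h k * \<psi> j"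
    using projective_algebra[of ?P] by blast
  then show ?thesis unfolding proj_related_def by (intro exI[of _ "\<chi> i. \<psi> i"]) simp
qed

section \<open>The metric equation and the structure equation\<close>

lemma sym_part_sym: "sym_part G x $ i $ j = sym_part G x $ j $ i"
  by (simp add: sym_part_def add.commute)

lemma lower_conn:
  assumes "det (sym_part G x) \<noteq> 0"
  shows "(\<Sum>p\<in>UNIV. sym_part G x $ i $ p * conn G p j k x) = conn_low G i j k x"
proof -
  have "(\<Sum>p\<in>UNIV. sym_part G x $ i $ p * sym_inv G x $ p $ q) = kron i q" for q
    using matrix_inv_right_det(1)[OF assms]
    by (simp add: vec_eq_iff matrix_matrix_mult_def sym_inv_def mat_def kron_def)
  then have "(\<Sum>q\<in>UNIV. (\<Sum>p\<in>UNIV. sym_part G x $ i $ p * sym_inv G x $ p $ q) * conn_low G q j k x)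
     = conn_low G i j k x" by (simp add: sum_kron)
  moreover have "(\<Sum>p\<in>UNIV. sym_part G x $ i $ p * conn G p j k x)
     = (\<Sum>p\<in>UNIV. \<Sum>q\<in>UNIV. sym_part G x $ i $ p * sym_inv G x $ p $ q * conn_low G q j k x)"
    by (simp add: conn_def sum_distrib_left mult.assoc)
  moreover have "\<dots> = (\<Sum>q\<in>UNIV. (\<Sum>p\<in>UNIV. sym_part G x $ i $ p * sym_inv G x $ p $ q) * conn_low G q j k x)"
    by (subst sum.swap) (simp add: sum_distrib_right)
  ultimately show ?thesis by simp
qed

lemma pd_sym_part:
  assumes "\<And>i j. (\<lambda>y. G y $ i $ j) differentiable (at x)"
  shows "pd k (\<lambda>y. sym_part G y $ i $ j) x = (pd k (\<lambda>y. G y $ i $ j) x + pd k (\<lambda>y. G y $ j $ i) x) / 2"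
proof -
  have "pd k (\<lambda>y. (G y $ i $ j + G y $ j $ i) * (1/2)) x
     = pd k (\<lambda>y. G y $ i $ j + G y $ j $ i) x * (1/2) + (G x $ i $ j + G x $ j $ i) * pd k (\<lambda>y. 1/2) x"
    using assms by (intro pd_mult differentiable_add) simp_all
  then show ?thesis by (simp add: sym_part_def pd_add[OF assms assms] pd_const)
qed

text \<open>With lowered index the two connection terms of the fourth-kind derivative are
  \<open>conn_low G j i k\<close> and \<open>conn_low G i j k\<close>, and their sum is the derivative of the symmetric part
  of the metric. This works for the fourth kind because the differentiation index is the second lower
  index in both terms.\<close>

lemma metric_parallel:
  assumes "det (sym_part G x) \<noteq> 0" "\<And>i j. (\<lambda>y. G y $ i $ j) differentiable (at x)"
  shows "cov4_low (conn G) (sym_part G) i j k x = 0"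
proof -
  have "(\<Sum>p\<in>UNIV. conn G p i k x * sym_part G x $ p $ j) = conn_low G j i k x"
    using lower_conn[OF assms(1), of j i k] by (simp add: sym_part_sym[of G x j] mult.commute)
  moreover have "(\<Sum>p\<in>UNIV. conn G p j k x * sym_part G x $ i $ p) = conn_low G i j k x"
    using lower_conn[OF assms(1), of i j k] by (simp add: mult.commute)
  ultimately show ?thesis
    by (simp add: cov4_low_def pd_sym_part[OF assms(2)] conn_low_def field_simps)
qed

text \<open>As the metric is parallel for its own connection, its derivative for another one contains no
  partial derivatives any more.\<close>

lemma cov4_low_diff:
  assumes "det (sym_part G x) \<noteq> 0" "\<And>i j. (\<lambda>y. G y $ i $ j) differentiable (at x)"
  shows "cov4_low C (sym_part G) i j k x =
     (\<Sum>p\<in>UNIV. (conn G p i k x - C p i k x) * sym_part G x $ p $ j)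
     + (\<Sum>p\<in>UNIV. (conn G p j k x - C p j k x) * sym_part G x $ i $ p)"
  using metric_parallel[OF assms, of i j k]
  by (simp add: cov4_low_def left_diff_distrib sum_subtractf)

lemma metric_equation_of_proj_related:
  assumes "det (sym_part G x) \<noteq> 0" "\<And>i j. (\<lambda>y. G y $ i $ j) differentiable (at x)"
    and P: "proj_related C (conn G) x w"
  shows "cov4_low C (sym_part G) i j k x =
     2 * w $ k * sym_part G x $ i $ j + w $ i * sym_part G x $ j $ k + w $ j * sym_part G x $ i $ k"
proof -
  have P': "conn G h j k x - C h j k x = kron h j * w $ k + kron h k * w $ j" for h j k
    using P by (simp add: proj_related_def)
  have "cov4_low C (sym_part G) i j k x =
     (\<Sum>p\<in>UNIV. kron p i * (w $ k * sym_part G x $ p $ j) + kron p k * (w $ i * sym_part G x $ p $ j))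
     + (\<Sum>p\<in>UNIV. kron p j * (w $ k * sym_part G x $ i $ p) + kron p k * (w $ j * sym_part G x $ i $ p))"
    unfolding cov4_low_diff[OF assms(1,2)] P' by (simp add: algebra_simps)
  also have "\<dots> = w $ k * sym_part G x $ i $ j + w $ i * sym_part G x $ k $ j
     + (w $ k * sym_part G x $ i $ j + w $ j * sym_part G x $ i $ k)"
    by (simp add: sum.distrib sum_kron)
  finally show ?thesis by (simp add: sym_part_sym[of G x k j])
qed

text \<open>Let \<open>E\<close> be the defect of the relation and \<open>Q\<close> the defect with lowered index. The metric
  equation says that \<open>Q i j k\<close> is skew in \<open>i\<close> and \<open>j\<close>; equal torsions say that it
  is symmetric in \<open>j\<close> and \<open>k\<close>. A tensor with both properties vanishes, and the
  nondegenerate metric carries this over to \<open>E\<close>.\<close>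

lemma proj_related_of_metric_equation:
  assumes nz: "det (sym_part G x) \<noteq> 0" and d: "\<And>i j. (\<lambda>y. G y $ i $ j) differentiable (at x)"
    and tors: "\<And>h j k. torsion (conn G) h j k x = torsion C h j k x"
    and eq: "\<And>i j k. cov4_low C (sym_part G) i j k x =
     2 * w $ k * sym_part G x $ i $ j + w $ i * sym_part G x $ j $ k + w $ j * sym_part G x $ i $ k"
  shows "proj_related C (conn G) x w"
proof -
  let ?S = "sym_part G x"
  define E where "E h j k = conn G h j k x - C h j k x - (kron h j * w $ k + kron h k * w $ j)" for h j k
  define Q where "Q i j k = (\<Sum>p\<in>UNIV. ?S $ i $ p * E p j k)" for i j k
  have Esym: "E h j k = E h k j" for h j k
    using tors[of h j k] by (simp add: E_def torsion_def)
  have Qsym: "Q i j k = Q i k j" for i j k using Esym by (simp add: Q_def)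
  have Qe: "(\<Sum>p\<in>UNIV. ?S $ i $ p * (conn G p j k x - C p j k x)) = Q i j k + ?S $ i $ j * w $ k + ?S $ i $ k * w $ j" for i j k
  proof -
    have "(\<Sum>p\<in>UNIV. ?S $ i $ p * (conn G p j k x - C p j k x))
      = (\<Sum>p\<in>UNIV. ?S $ i $ p * E p j k + kron p j * (?S $ i $ p * w $ k) + kron p k * (?S $ i $ p * w $ j))"
      by (intro sum.cong) (auto simp: E_def algebra_simps)
    then show ?thesis by (simp add: sum.distrib sum_kron Q_def)
  qed
  have anti: "Q i j k = - Q j i k" for i j k
  proof -
    have "cov4_low C (sym_part G) i j k x =
       (\<Sum>p\<in>UNIV. ?S $ j $ p * (conn G p i k x - C p i k x)) + (\<Sum>p\<in>UNIV. ?S $ i $ p * (conn G p j k x - C p j k x))"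
      unfolding cov4_low_diff[OF nz d] by (simp add: sym_part_sym[of G x j] mult.commute)
    then have "2 * w $ k * ?S $ i $ j + w $ i * ?S $ j $ k + w $ j * ?S $ i $ k
       = Q j i k + ?S $ j $ i * w $ k + ?S $ j $ k * w $ i + (Q i j k + ?S $ i $ j * w $ k + ?S $ i $ k * w $ j)"
      using eq[of i j k] by (simp add: Qe)
    then show ?thesis by (simp add: sym_part_sym[of G x j i] algebra_simps)
  qed
  \<comment> \<open>Alternating the two symmetries six times returns to the initial indices with the opposite sign.\<close>
  have Q0: "Q i j k = 0" for i j k
    using anti[of i j k] Qsym[of j i k] anti[of j k i] Qsym[of k j i] anti[of k i j] Qsym[of i k j] by linarith
  have "E h j k = 0" for h j k
  proof -
    have "?S *v (\<chi> p. E p j k) = 0" using Q0 by (simp add: vec_eq_iff matrix_vector_mult_def Q_def)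
    then have "(\<chi> p. E p j k) = (0 :: real^'a)"
      using bilin_nondegenerate[OF nz, of "\<chi> p. E p j k" 0] by (simp add: bilin_def)
    then show ?thesis by (simp add: vec_eq_iff)
  qed
  then show ?thesis unfolding proj_related_def E_def by (simp add: algebra_simps)
qed

text \<open>The terms with \<open>w $ k\<close> coming from the upper and from the lower index of \<open>T\<close> cancel.\<close>

lemma structure_equation_of_proj_related:
  assumes "proj_related C Cb x w"
  shows "cov4_mixed C T h i k x = cov4_mixed Cb T h i k x
     - (\<Sum>p\<in>UNIV. w $ p * kron h k * T x $ p $ i) + w $ i * T x $ h $ k"
proof -
  have P': "Cb h j k x = C h j k x + (kron h j * w $ k + kron h k * w $ j)" for h j k
    using assms unfolding proj_related_def by (metis add_diff_cancel_left' diff_add_cancel add.commute)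
  have "(\<Sum>p\<in>UNIV. Cb h k p x * T x $ p $ i) = (\<Sum>p\<in>UNIV. C h k p x * T x $ p $ i
       + w $ p * kron h k * T x $ p $ i + kron h p * (w $ k * T x $ p $ i))"
    by (intro sum.cong) (auto simp: P' algebra_simps)
  then have 1: "(\<Sum>p\<in>UNIV. Cb h k p x * T x $ p $ i) = (\<Sum>p\<in>UNIV. C h k p x * T x $ p $ i)
       + (\<Sum>p\<in>UNIV. w $ p * kron h k * T x $ p $ i) + w $ k * T x $ h $ i"
    by (simp add: sum.distrib sum_kron)
  have "(\<Sum>p\<in>UNIV. Cb p i k x * T x $ h $ p) = (\<Sum>p\<in>UNIV. C p i k x * T x $ h $ p
       + kron p i * (w $ k * T x $ h $ p) + kron p k * (w $ i * T x $ h $ p))"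
    by (intro sum.cong) (auto simp: P' algebra_simps)
  then have 2: "(\<Sum>p\<in>UNIV. Cb p i k x * T x $ h $ p) = (\<Sum>p\<in>UNIV. C p i k x * T x $ h $ p)
       + w $ k * T x $ h $ i + w $ i * T x $ h $ k"
    by (simp add: sum.distrib sum_kron)
  show ?thesis unfolding cov4_mixed_def 1 2 by simp
qed

section \<open>The structure and the metric\<close>

text \<open>In matrix form the three conditions are $SF = -F^T S$, $F^T S F = S$ and
  $S^{-1} = F S^{-1} F^T$. Multiplying the second one by $F$ on the right and using $F^2 = -1$
  gives the first; multiplying the first by $F^T$ on the left gives the second. The first also shows that $F S^{-1} F^T$ is a right
  inverse of $S$.\<close>

lemma hermitian_iff:
  fixes F S :: "real^'n^'n"
  assumes S: "\<And>i j. S $ i $ j = S $ j $ i" "det S \<noteq> 0"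
    and F: "\<And>h i. (\<Sum>p\<in>UNIV. F $ h $ p * F $ p $ i) = - kron h i"
  shows "(\<forall>i j. (\<Sum>a\<in>UNIV. F $ a $ i * S $ a $ j) + (\<Sum>a\<in>UNIV. F $ a $ j * S $ a $ i) = 0) \<longleftrightarrow>
    (\<forall>i j. (\<Sum>p\<in>UNIV. \<Sum>q\<in>UNIV. S $ p $ q * F $ p $ i * F $ q $ j) = S $ i $ j) \<and>
    (\<forall>i j. matrix_inv S $ i $ j = (\<Sum>p\<in>UNIV. \<Sum>q\<in>UNIV. matrix_inv S $ p $ q * F $ i $ p * F $ j $ q))"
proof -
  let ?T = "transpose F" and ?R = "matrix_inv S"
  have FF: "F ** F = - mat 1"
    using F by (simp add: vec_eq_iff matrix_matrix_mult_def mat_def kron_def)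
  have "?T ** ?T = transpose (F ** F)" by (simp add: matrix_transpose_mul)
  also have "\<dots> = - mat 1" unfolding FF by (simp add: vec_eq_iff transpose_def mat_def)
  finally have TT: "?T ** ?T = - mat 1" .
  have neg: "(- A) ** B = - (A ** B)" "A ** (- B) = - (A ** B)" for A B :: "real^'n^'n"
    by (simp_all add: vec_eq_iff matrix_matrix_mult_def sum_negf)
  have c1: "(\<forall>i j. (\<Sum>a\<in>UNIV. F $ a $ i * S $ a $ j) + (\<Sum>a\<in>UNIV. F $ a $ j * S $ a $ i) = 0)
     \<longleftrightarrow> S ** F = - (?T ** S)"
  proof -
    have "(\<Sum>a\<in>UNIV. F $ a $ i * S $ a $ j) = (?T ** S) $ i $ j" for i j
      by (simp add: matrix_matrix_mult_def transpose_def)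
    moreover have "(\<Sum>a\<in>UNIV. F $ a $ j * S $ a $ i) = (S ** F) $ i $ j" for i j
      by (simp add: matrix_matrix_mult_def S(1)[of i] mult.commute)
    ultimately show ?thesis by (simp add: vec_eq_iff eq_neg_iff_add_eq_0 add.commute)
  qed
  have c2: "(\<forall>i j. (\<Sum>p\<in>UNIV. \<Sum>q\<in>UNIV. S $ p $ q * F $ p $ i * F $ q $ j) = S $ i $ j)
     \<longleftrightarrow> ?T ** (S ** F) = S"
    by (simp add: vec_eq_iff matrix_matrix_mult_def transpose_def sum_distrib_left mult_ac)
  have c3: "(\<forall>i j. ?R $ i $ j = (\<Sum>p\<in>UNIV. \<Sum>q\<in>UNIV. ?R $ p $ q * F $ i $ p * F $ j $ q))
     \<longleftrightarrow> ?R = F ** (?R ** ?T)"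
    by (simp add: vec_eq_iff matrix_matrix_mult_def transpose_def sum_distrib_left mult_ac)
  have "S ** F = - (?T ** S)" if "?T ** (S ** F) = S"
  proof -
    have "S ** F = (?T ** (S ** F)) ** F" using that by simp
    also have "\<dots> = ?T ** (S ** (F ** F))" by (simp add: matrix_mul_assoc)
    also have "\<dots> = - (?T ** S)" unfolding FF neg by simp
    finally show ?thesis .
  qed
  moreover have "?T ** (S ** F) = S \<and> ?R = F ** (?R ** ?T)" if "S ** F = - (?T ** S)"
  proof
    show "?T ** (S ** F) = S" unfolding that neg matrix_mul_assoc TT by simp
    have "S ** (F ** (?R ** ?T)) = (S ** F) ** (?R ** ?T)" by (simp add: matrix_mul_assoc)
    also have "\<dots> = - (?T ** ((S ** ?R) ** ?T))" unfolding that neg by (simp add: matrix_mul_assoc)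
    also have "\<dots> = mat 1" by (simp add: matrix_inv_right_det[OF S(2)] TT)
    finally have "?R ** (S ** (F ** (?R ** ?T))) = ?R" by simp
    then show "?R = F ** (?R ** ?T)"
      by (simp add: matrix_mul_assoc matrix_inv_right_det[OF S(2)])
  qed
  ultimately show ?thesis unfolding c1 c2 c3 by blast
qed

section \<open>Autoparallel curves\<close>

lemma autoparallel_at_spray:
  "autoparallel_at C \<gamma> t \<longleftrightarrow> (\<exists>v a \<rho>.
     (\<forall>\<^sub>F s in nhds t. (\<gamma> has_vector_derivative v s) (at s)) \<and>
     (v has_vector_derivative a) (at t) \<and> v t \<noteq> 0 \<and> a + spray C (\<gamma> t) (v t) = \<rho> *\<^sub>R v t)"
  unfolding autoparallel_at_def by (simp add: vec_eq_iff spray_def)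

lemma autoparallel_at_cong:
  assumes "\<forall>\<^sub>F s in nhds t. \<gamma> s = \<delta> s" "autoparallel_at C \<gamma> t"
  shows "autoparallel_at C \<delta> t"
proof -
  obtain v a \<rho> where v: "\<forall>\<^sub>F s in nhds t. (\<gamma> has_vector_derivative v s) (at s)"
     "(v has_vector_derivative a) (at t)" "v t \<noteq> 0" "a + spray C (\<gamma> t) (v t) = \<rho> *\<^sub>R v t"
    using assms(2) unfolding autoparallel_at_spray by blast
  obtain U where U: "open U" "t \<in> U" "\<And>s. s \<in> U \<Longrightarrow> \<gamma> s = \<delta> s"
    using assms(1) unfolding eventually_nhds by blast
  have "\<forall>\<^sub>F s in nhds t. s \<in> U" using U eventually_nhds_in_open by blast
  with v(1) have "\<forall>\<^sub>F s in nhds t. (\<delta> has_vector_derivative v s) (at s)"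
  proof eventually_elim
    case (elim s)
    then show ?case using has_vector_derivative_transform_within_open U by blast
  qed
  moreover have "\<gamma> t = \<delta> t" using U by blast
  ultimately show ?thesis using v unfolding autoparallel_at_spray by auto
qed

text \<open>The definition of an autoparallel curve only asserts that some velocity and acceleration exist;
  they are the given ones, since derivatives are unique.\<close>

lemma autoparallel_at_unique:
  assumes "\<forall>\<^sub>F s in nhds t. (\<gamma> has_vector_derivative v s) (at s)" "(v has_vector_derivative a) (at t)"
    "autoparallel_at C \<gamma> t"
  shows "\<exists>\<rho>. a + spray C (\<gamma> t) (v t) = \<rho> *\<^sub>R v t"
proof -
  obtain w b \<rho> where w: "\<forall>\<^sub>F s in nhds t. (\<gamma> has_vector_derivative w s) (at s)"
     "(w has_vector_derivative b) (at t)" "b + spray C (\<gamma> t) (w t) = \<rho> *\<^sub>R w t"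
    using assms(3) unfolding autoparallel_at_spray by blast
  have "\<forall>\<^sub>F s in nhds t. w s = v s"
    using assms(1) w(1) by eventually_elim (rule vector_derivative_unique_at)
  then obtain U where U: "open U" "t \<in> U" "\<And>s. s \<in> U \<Longrightarrow> w s = v s"
    unfolding eventually_nhds by blast
  have "(v has_vector_derivative b) (at t)"
    by (rule has_vector_derivative_transform_within_open[OF w(2) U])
  then have "b = a" using assms(2) vector_derivative_unique_at by blast
  then show ?thesis using w(3) U by auto
qed

text \<open>The multiple of the velocity by which the two connections differ is absorbed by the factor
  of proportionality.\<close>

lemma autoparallel_at_proj_related:
  assumes "autoparallel_at C \<gamma> t" "proj_related C Cb (\<gamma> t) w"
  shows "autoparallel_at Cb \<gamma> t"
proof -
  obtain v a \<rho> where v: "\<forall>\<^sub>F s in nhds t. (\<gamma> has_vector_derivative v s) (at s)"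
     "(v has_vector_derivative a) (at t)" "v t \<noteq> 0" "a + spray C (\<gamma> t) (v t) = \<rho> *\<^sub>R v t"
    using assms(1) unfolding autoparallel_at_spray by blast
  have "a + spray Cb (\<gamma> t) (v t) = (\<rho> + 2 * (w \<bullet> v t)) *\<^sub>R v t"
    using v(4) by (simp add: proj_related_spray[OF assms(2)] scaleR_add_left add.assoc[symmetric])
  then show ?thesis using v unfolding autoparallel_at_spray by blast
qed

text \<open>The acceleration of the transformed curve is the transformed acceleration plus the second derivative
  of the transition map at the velocity. The inhomogeneous term in \<open>spray_conn_transform\<close> is
  equal to this extra term, so that they cancel in the autoparallel equation.\<close>

lemma autoparallel_at_trans_map:
  fixes c d :: "('a, 'n::finite) chart"
  assumes GR: "gen_riemannian X A g" and cd: "c \<in> A" "d \<in> A" and x: "\<gamma> t \<in> overlap c d"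
    and ap: "autoparallel_at (conn (g c)) \<gamma> t"
  shows "autoparallel_at (conn (g d)) (\<lambda>s. trans_map c d (\<gamma> s)) t"
proof -
  have M: "smooth_manifold X A" using GR by (simp add: gen_riemannian_def)
  note ch = atlas_chart[OF M cd(1)] atlas_chart[OF M cd(2)]
  obtain v a \<rho> where v: "\<forall>\<^sub>F s in nhds t. (\<gamma> has_vector_derivative v s) (at s)"
     "(v has_vector_derivative a) (at t)" "v t \<noteq> 0" "a + spray (conn (g c)) (\<gamma> t) (v t) = \<rho> *\<^sub>R v t"
    using ap unfolding autoparallel_at_spray by blast
  let ?J = "jac_mat c d" and ?T = "trans_map c d"
  have \<gamma>t: "(\<gamma> has_vector_derivative v t) (at t)" using v(1) eventually_nhds_x_imp_x by blast
  then have "isCont \<gamma> t" by (rule has_vector_derivative_continuous)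
  then have "\<forall>\<^sub>F s in nhds t. \<gamma> s \<in> overlap c d"
    using x overlap_open[OF ch] unfolding continuous_at_open eventually_nhds by metis
  with v(1) have 1: "\<forall>\<^sub>F s in nhds t. ((\<lambda>s. ?T (\<gamma> s)) has_vector_derivative ?J (\<gamma> s) *v v s) (at s)"
  proof eventually_elim
    case (elim s)
    have "((\<lambda>s. ?T (\<gamma> s)) has_derivative (\<lambda>h. ?J (\<gamma> s) *v (h *\<^sub>R v s))) (at s)"
      by (rule has_derivative_compose[where f = \<gamma> and g = "?T", OF _ trans_map_has_derivative[OF M cd elim(2)]])
        (use elim(1) in \<open>simp add: has_vector_derivative_def\<close>)
    then show ?case by (simp add: has_vector_derivative_def matrix_vector_mult_scaleR)
  qed
  have "((\<lambda>s. ?J (\<gamma> s)) has_derivative (\<lambda>h. mat_dir_deriv ?J (\<gamma> t) (h *\<^sub>R v t))) (at t)"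
    by (rule has_derivative_compose[where f = \<gamma> and g = "?J", OF _ jac_mat_has_derivative[OF M cd x]])
      (use \<gamma>t in \<open>simp add: has_vector_derivative_def\<close>)
  from has_derivative_matrix_vector_mult[OF this] v(2)
  have "((\<lambda>s. ?J (\<gamma> s) *v v s) has_derivative
     (\<lambda>h. ?J (\<gamma> t) *v (h *\<^sub>R a) + mat_dir_deriv ?J (\<gamma> t) (h *\<^sub>R v t) *v v t)) (at t)"
    unfolding has_vector_derivative_def by blast
  moreover have "mat_dir_deriv ?J (\<gamma> t) (h *\<^sub>R v t) *v v t = h *\<^sub>R (mat_dir_deriv ?J (\<gamma> t) (v t) *v v t)" for h
    by (simp add: vec_eq_iff mat_dir_deriv_def matrix_vector_mult_def sum_distrib_left sum_distrib_right mult_ac)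
  ultimately have 2: "((\<lambda>s. ?J (\<gamma> s) *v v s) has_vector_derivative
      ?J (\<gamma> t) *v a + mat_dir_deriv ?J (\<gamma> t) (v t) *v v t) (at t)"
    by (simp add: has_vector_derivative_def matrix_vector_mult_scaleR scaleR_add_right)
  have 3: "?J (\<gamma> t) *v v t \<noteq> 0"
    using jac_mat_inverse[OF M cd x, of "v t"] v(3) by (metis matrix_vector_mult_0_right)
  have "?J (\<gamma> t) *v a + mat_dir_deriv ?J (\<gamma> t) (v t) *v v t + spray (conn (g d)) (?T (\<gamma> t)) (?J (\<gamma> t) *v v t)
     = ?J (\<gamma> t) *v (a + spray (conn (g c)) (\<gamma> t) (v t))"
    by (simp add: matrix_vector_right_distrib spray_conn_transform[OF GR cd x] add.assoc)
  also have "\<dots> = \<rho> *\<^sub>R (?J (\<gamma> t) *v v t)" unfolding v(4) by (simp add: matrix_vector_mult_scaleR)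
  finally show ?thesis unfolding autoparallel_at_spray using 1 2 3
    by (intro exI[of _ "\<lambda>s. ?J (\<gamma> s) *v v s"] exI[of _ "?J (\<gamma> t) *v a + mat_dir_deriv ?J (\<gamma> t) (v t) *v v t"] exI[of _ \<rho>]) simp
qed

section \<open>Geodesics through a given point\<close>

text \<open>A solution of the geodesic equation in the coordinates of \<open>c\<close> is carried to the manifold by
  the inverse chart, and to any other chart by the transition map. The statement also provides the
  velocity and the acceleration at time \<open>0\<close>, where the curve is compared with its image under
  a mapping.\<close>

lemma geodesic_exists:
  fixes c :: "('a, 'n::finite) chart"
  assumes GR: "gen_riemannian X A g" and c: "c \<in> A" and x0: "x0 \<in> coord_dom c" and v0: "v0 \<noteq> 0"
  shows "\<exists>h>0. \<exists>\<gamma> v. \<gamma> 0 = x0 \<and> v 0 = v0 \<and>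
    (\<forall>t\<in>{-h<..<h}. \<gamma> t \<in> coord_dom c \<and> (\<gamma> has_vector_derivative v t) (at t)) \<and>
    (v has_vector_derivative - spray (conn (g c)) x0 v0) (at 0) \<and>
    geodesic X A g (-h) h (\<lambda>t. chart_inv c (\<gamma> t))"
proof -
  have M: "smooth_manifold X A" and T: "tensor02_field A g"
    and nz: "\<And>c x. c \<in> A \<Longrightarrow> x \<in> coord_dom c \<Longrightarrow> det (sym_part (g c) x) \<noteq> 0"
    using GR by (auto simp: gen_riemannian_def)
  have ch: "is_chart X c" using M c by (rule atlas_chart)
  have op: "open (coord_dom c)" by (rule chart_open_dom[OF ch])
  have sm: "smooth_on (coord_dom c) (conn (g c) h j k)" for h j k
    using T c nz by (intro smooth_on_conn[OF op]) (auto simp: tensor02_field_def)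
  obtain h \<gamma> v where h: "h > 0" and \<gamma>0: "\<gamma> 0 = x0" and v0': "v 0 = v0"
    and sol: "\<And>t. t \<in> {-h<..<h} \<Longrightarrow> \<gamma> t \<in> coord_dom c \<and> v t \<noteq> 0 \<and> (\<gamma> has_vector_derivative v t) (at t) \<and>
       (v has_vector_derivative - spray (conn (g c)) (\<gamma> t) (v t)) (at t)"
    using autoparallel_exists[where C = "conn (g c)", OF op x0 sm v0] by blast
  have cont: "continuous_map (top_of_set {-h<..<h}) X (\<lambda>t. chart_inv c (\<gamma> t))"
  proof -
    have "continuous_on {-h<..<h} \<gamma>"
      using sol by (intro continuous_at_imp_continuous_on ballI has_vector_derivative_continuous) blast
    then have "continuous_map (top_of_set {-h<..<h}) (top_of_set (coord_dom c)) \<gamma>"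
      using sol by (auto simp: continuous_map_in_subtopology)
    from continuous_map_compose[OF this chart_inv_continuous[OF ch]] show ?thesis by (simp add: o_def)
  qed
  have ap: "autoparallel_at (conn (g d)) (snd d \<circ> (\<lambda>t. chart_inv c (\<gamma> t))) t"
    if d: "d \<in> A" and t: "t \<in> {-h<..<h}" and l: "chart_inv c (\<gamma> t) \<in> fst d" for d t
  proof -
    have "\<forall>\<^sub>F s in nhds t. s \<in> {-h<..<h}" using t by (intro eventually_nhds_in_open) auto
    then have "\<forall>\<^sub>F s in nhds t. (\<gamma> has_vector_derivative v s) (at s)"
      by eventually_elim (use sol in blast)
    \<comment> \<open>The parameter is affine, so the factor of proportionality is \<open>0\<close>.\<close>
    then have 1: "autoparallel_at (conn (g c)) \<gamma> t" unfolding autoparallel_at_spray using sol[OF t]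
      by (intro exI[of _ v] exI[of _ "- spray (conn (g c)) (\<gamma> t) (v t)"] exI[of _ 0]) simp
    have "\<gamma> t \<in> overlap c d" using sol[OF t] l overlap_iff[OF ch] by blast
    from autoparallel_at_trans_map[OF GR c d this 1] show ?thesis by (simp add: trans_map_def o_def)
  qed
  have "geodesic X A g (-h) h (\<lambda>t. chart_inv c (\<gamma> t))"
    unfolding geodesic_def using h cont ap by simp
  moreover have "(v has_vector_derivative - spray (conn (g c)) x0 v0) (at 0)"
    using sol[of 0] h \<gamma>0 v0' by simp
  ultimately show ?thesis using h \<gamma>0 v0' sol
    by (intro exI[of _ h] conjI exI[of _ \<gamma>] exI[of _ v] ballI) simp_all
qed

section \<open>Pushing charts forward along a diffeomorphism\<close>

lemma smooth_vec_on_cong: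
  assumes "open S" "\<And>x. x \<in> S \<Longrightarrow> u x = v x" "smooth_vec_on S u"
  shows "smooth_vec_on S v"
  unfolding smooth_vec_on_def
proof
  fix i
  show "smooth_on S (\<lambda>x. v x $ i)"
    by (rule smooth_on_cong[OF assms(1), of "\<lambda>x. u x $ i"]) (use assms in \<open>auto simp: smooth_vec_on_def\<close>)
qed

lemma push_chart_sel:
  "fst (push_chart X f c) = f ` fst c" "snd (push_chart X f c) q = snd c (inv_into (topspace X) f q)"
  by (simp_all add: push_chart_def)

lemma diffeo_inj: "diffeo X A Y B f \<Longrightarrow> inj_on f (topspace X)"
  by (auto simp: diffeo_def bij_betw_def)

lemma push_chart_apply:
  assumes "inj_on f (topspace X)" "fst c \<subseteq> topspace X" "p \<in> fst c"
  shows "snd (push_chart X f c) (f p) = snd c p"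
  using assms by (simp add: push_chart_sel inv_into_f_f subset_iff)

lemma coord_dom_push_chart:
  assumes "inj_on f (topspace X)" "fst c \<subseteq> topspace X"
  shows "coord_dom (push_chart X f c) = coord_dom c"
  unfolding coord_dom_def push_chart_sel(1) image_image
  by (rule image_cong[OF refl push_chart_apply[OF assms]])

text \<open>The values of \<open>snd (push_chart X f c)\<close> and of \<open>chart_inv\<close> outside the relevant domains are
  arbitrary, so the expected formulas hold on \<open>coord_dom c\<close> only. As this set is open, they
  may still be differentiated there.\<close>

lemma chart_inv_push_chart:
  assumes "is_chart X c" "inj_on f (topspace X)" "x \<in> coord_dom c"
  shows "chart_inv (push_chart X f c) x = f (chart_inv c x)"
proof -
  let ?e = "push_chart X f c"
  note s = chart_dom_subset[OF assms(1)]
  have x: "x \<in> coord_dom ?e" using coord_dom_push_chart[OF assms(2) s] assms(3) by simp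
  obtain p where p: "p \<in> fst c" "chart_inv ?e x = f p"
    using chart_inv_in[OF x] by (auto simp: push_chart_sel)
  have "snd c p = x" using chart_chart_inv[OF x] p push_chart_apply[OF assms(2) s p(1)] by simp
  then show ?thesis using p chart_inv_chart[OF assms(1) p(1)] by simp
qed

lemma trans_map_push_chart:
  assumes "is_chart X c" "inj_on f (topspace X)" "x \<in> coord_dom c"
  shows "trans_map (push_chart X f c) (push_chart X f d) x = trans_map c d x"
  using chart_inv_in[OF assms(3)] chart_dom_subset[OF assms(1)] assms(2)
  by (simp add: trans_map_def chart_inv_push_chart[OF assms] push_chart_sel inv_into_f_f subset_iff)

lemma jac_push_chart:
  fixes c d :: "('a, 'n::finite) chart"
  assumes "is_chart X c" "inj_on f (topspace X)" "x \<in> coord_dom c"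
  shows "jac (push_chart X f c) (push_chart X f d) x a i = jac c d x a i"
  unfolding jac_def
  by (rule pd_cong_open[OF chart_open_dom[OF assms(1)] assms(3)]) (simp add: trans_map_push_chart[OF assms(1,2)])

lemma overlap_push_chart:
  assumes "is_chart X c" "is_chart X d" "inj_on f (topspace X)"
  shows "overlap (push_chart X f c) (push_chart X f d) = overlap c d"
proof -
  note s = chart_dom_subset[OF assms(1)] chart_dom_subset[OF assms(2)]
  have "f ` fst c \<inter> f ` fst d = f ` (fst c \<inter> fst d)"
    using inj_on_image_Int[OF assms(3) s] by simp
  then show ?thesis
    unfolding overlap_def push_chart_sel(1) by (simp add: image_image push_chart_apply[OF assms(3) s(1)] cong: image_cong_simp)
qed

lemma push_chart_is_chart:
  fixes c :: "('a, 'n::finite) chart" and Y :: "'b topology"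
  assumes f: "diffeo X A Y B f" and ch: "is_chart X c"
  shows "is_chart Y (push_chart X f c)"
proof -
  let ?e = "push_chart X f c" and ?i = "inv_into (topspace X) f"
  note inj = diffeo_inj[OF f] and s = chart_dom_subset[OF ch]
  have img: "f ` topspace X = topspace Y" using f by (auto simp: diffeo_def bij_betw_def)
  have hm: "homeomorphic_maps Y X ?i f"
    unfolding homeomorphic_maps_def
    using f img inj by (auto simp: diffeo_def smooth_map_def f_inv_into_f)
  then have fo: "open_map X Y f"
    using homeomorphic_maps_map[of Y X ?i f] homeomorphic_imp_open_map[of X Y f] by simp
  have o: "openin Y (f ` fst c)" using fo chart_openin[OF ch] by (auto simp: open_map_def)
  have "?i ` (topspace Y \<inter> f ` fst c) = topspace X \<inter> fst c"
  proof -
    have "topspace Y \<inter> f ` fst c = f ` fst c" using img s by blast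
    moreover have "?i ` f ` fst c = fst c" using inj s by (simp add: image_inv_into_cancel inv_into_image_cancel)
    ultimately show ?thesis using s by auto
  qed
  from homeomorphic_maps_subtopologies[OF hm this]
  have "homeomorphic_map (subtopology Y (f ` fst c)) (subtopology X (fst c)) ?i"
    using homeomorphic_maps_map by blast
  from homeomorphic_map_compose[OF this chart_homeo[OF ch]]
  have "homeomorphic_map (subtopology Y (fst ?e)) (top_of_set (coord_dom ?e)) (snd ?e)"
    unfolding coord_dom_push_chart[OF inj s] by (simp add: push_chart_def)
  then show ?thesis unfolding is_chart_def
    using o chart_open_dom[OF ch] by (simp add: push_chart_sel(1) coord_dom_push_chart[OF inj s])
qed

text \<open>The two transition maps between the pushed chart and a chart \<open>d\<close> of the target are the local
  expressions of \<open>f\<close> and of its inverse, which are smooth by assumption; then maximality of the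
  target atlas applies.\<close>

lemma push_chart_in_atlas:
  fixes c :: "('a, 'n::finite) chart" and Y :: "'b topology"
  assumes f: "diffeo X A Y B f" and MX: "smooth_manifold X A" and MY: "smooth_manifold Y B" and c: "c \<in> A"
  shows "push_chart X f c \<in> B"
proof -
  let ?e = "push_chart X f c" and ?i = "inv_into (topspace X) f"
  have ch: "is_chart X c" using MX c by (rule atlas_chart)
  have e: "is_chart Y ?e" by (rule push_chart_is_chart[OF f ch])
  note inj = diffeo_inj[OF f] and s = chart_dom_subset[OF ch]
  have img: "f ` topspace X = topspace Y" using f by (auto simp: diffeo_def bij_betw_def)
  have "compatible ?e d" if d: "d \<in> B" for d
    unfolding compatible_def
  proof
    have chd: "is_chart Y d" using MY d by (rule atlas_chart)
    have ov: "overlap ?e d = snd c ` {p \<in> fst c. f p \<in> fst d}"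
    proof -
      have "f ` fst c \<inter> fst d = f ` {p \<in> fst c. f p \<in> fst d}" by blast
      then have "overlap ?e d = (\<lambda>p. snd ?e (f p)) ` {p \<in> fst c. f p \<in> fst d}"
        by (simp add: overlap_def push_chart_sel(1) image_image)
      also have "\<dots> = snd c ` {p \<in> fst c. f p \<in> fst d}"
        by (rule image_cong[OF refl]) (simp add: push_chart_apply[OF inj s])
      finally show ?thesis .
    qed
    have "smooth_vec_on (overlap ?e d) (snd d \<circ> f \<circ> chart_inv c)"
      unfolding ov using f c d by (auto simp: diffeo_def smooth_map_def)
    then show "smooth_vec_on (overlap ?e d) (trans_map ?e d)"
    proof (rule smooth_vec_on_cong[OF overlap_open[OF e chd], rotated])
      fix x assume "x \<in> overlap ?e d"
      then have "x \<in> coord_dom c" using overlap_subset coord_dom_push_chart[OF inj s] by blast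
      then show "(snd d \<circ> f \<circ> chart_inv c) x = trans_map ?e d x"
        by (simp add: trans_map_def chart_inv_push_chart[OF ch inj])
    qed
    have "fst d \<inter> f ` fst c = {q \<in> fst d. ?i q \<in> fst c}"
    proof (intro equalityI subsetI)
      fix q assume "q \<in> fst d \<inter> f ` fst c"
      then show "q \<in> {q \<in> fst d. ?i q \<in> fst c}" using inj s by (auto simp: inv_into_f_f subset_iff)
    next
      fix q assume q: "q \<in> {q \<in> fst d. ?i q \<in> fst c}"
      then have "q \<in> f ` topspace X" using img chart_dom_subset[OF chd] by blast
      then have "f (?i q) = q" by (rule f_inv_into_f)
      then show "q \<in> fst d \<inter> f ` fst c" using q by (metis (mono_tags, lifting) IntI image_eqI mem_Collect_eq)
    qed
    then have "overlap d ?e = snd d ` {q \<in> fst d. ?i q \<in> fst c}"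
      by (simp add: overlap_def push_chart_sel(1))
    moreover have "trans_map d ?e = snd c \<circ> ?i \<circ> chart_inv d"
      by (simp add: trans_map_def push_chart_def)
    moreover have "smooth_vec_on (snd d ` {q \<in> fst d. ?i q \<in> fst c}) (snd c \<circ> ?i \<circ> chart_inv d)"
      using f c d by (auto simp: diffeo_def smooth_map_def)
    ultimately show "smooth_vec_on (overlap d ?e) (trans_map d ?e)" by simp
  qed
  moreover have "\<forall>c. is_chart Y c \<and> (\<forall>d\<in>B. compatible c d) \<longrightarrow> c \<in> B"
    using MY unfolding smooth_manifold_def by (elim conjE)
  ultimately show ?thesis using e by blast
qed

text \<open>Pushed charts have the same overlaps and the same transition maps as the original ones, so the
  transformation law is inherited as it stands.\<close>

lemma tensor02_pullback:
  assumes f: "diffeo X A Y B f" and MX: "smooth_manifold X A" and MY: "smooth_manifold Y B"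
    and G: "tensor02_field B G"
  shows "tensor02_field A (\<lambda>c. G (push_chart X f c))"
  unfolding tensor02_field_def
proof (intro conjI ballI allI)
  note inj = diffeo_inj[OF f] and pB = push_chart_in_atlas[OF f MX MY]
  fix c i j assume c: "c \<in> A"
  note ch = atlas_chart[OF MX c]
  show "smooth_on (coord_dom c) (\<lambda>x. G (push_chart X f c) x $ i $ j)"
    using G pB[OF c] coord_dom_push_chart[OF inj chart_dom_subset[OF ch]] unfolding tensor02_field_def by metis
  fix d x assume d: "d \<in> A" and x: "x \<in> overlap c d"
  note chd = atlas_chart[OF MX d]
  have xc: "x \<in> coord_dom c" using x overlap_subset by blast
  have "x \<in> overlap (push_chart X f c) (push_chart X f d)" using x overlap_push_chart[OF ch chd inj] by simp
  then show "G (push_chart X f c) x $ i $ j = (\<Sum>a\<in>UNIV. \<Sum>b\<in>UNIV. jac c d x a i * jac c d x b j *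
     G (push_chart X f d) (trans_map c d x) $ a $ b)"
    using G pB[OF c] pB[OF d] unfolding tensor02_field_def
    by (simp add: jac_push_chart[OF ch inj xc] trans_map_push_chart[OF ch inj xc])
qed

lemma tensor11_pullback:
  assumes f: "diffeo X A Y B f" and MX: "smooth_manifold X A" and MY: "smooth_manifold Y B"
    and F: "tensor11_field B F"
  shows "tensor11_field A (\<lambda>c. F (push_chart X f c))"
  unfolding tensor11_field_def
proof (intro conjI ballI allI)
  note inj = diffeo_inj[OF f] and pB = push_chart_in_atlas[OF f MX MY]
  fix c h i assume c: "c \<in> A"
  note ch = atlas_chart[OF MX c]
  show "smooth_on (coord_dom c) (\<lambda>x. F (push_chart X f c) x $ h $ i)"
    using F pB[OF c] coord_dom_push_chart[OF inj chart_dom_subset[OF ch]] unfolding tensor11_field_def by metis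
  fix d x assume d: "d \<in> A" and x: "x \<in> overlap c d"
  note chd = atlas_chart[OF MX d]
  have xc: "x \<in> coord_dom c" using x overlap_subset by blast
  have td: "trans_map c d x \<in> coord_dom d" using trans_map_overlap(1)[OF ch chd x] overlap_subset by blast
  have "x \<in> overlap (push_chart X f c) (push_chart X f d)" using x overlap_push_chart[OF ch chd inj] by simp
  then show "F (push_chart X f c) x $ h $ i = (\<Sum>a\<in>UNIV. \<Sum>b\<in>UNIV. jac d c (trans_map c d x) h a *
     jac c d x b i * F (push_chart X f d) (trans_map c d x) $ a $ b)"
    using F pB[OF c] pB[OF d] unfolding tensor11_field_def
    by (simp add: jac_push_chart[OF ch inj xc] jac_push_chart[OF chd inj td] trans_map_push_chart[OF ch inj xc])
qed

section \<open>The covector of a geodesic mapping\<close>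

text \<open>In the common coordinates a geodesic and its image are the same curve, autoparallel for both
  connections. Subtracting the two autoparallel equations at time \<open>0\<close> eliminates the acceleration.\<close>

lemma geodesic_mapping_spray:
  fixes c :: "('a, 'n::finite) chart" and Y :: "'b topology"
  assumes GR: "gen_riemannian X A g" and MY: "smooth_manifold Y B"
    and f: "geodesic_mapping X A g Y B gbar f" and c: "c \<in> A" and x0: "x0 \<in> coord_dom c" and v0: "v0 \<noteq> 0"
  shows "\<exists>\<rho>. spray (conn (gbar (push_chart X f c))) x0 v0 - spray (conn (g c)) x0 v0 = \<rho> *\<^sub>R v0"
proof -
  let ?e = "push_chart X f c"
  have df: "diffeo X A Y B f" using f by (simp add: geodesic_mapping_def)
  have MX: "smooth_manifold X A" using GR by (simp add: gen_riemannian_def)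
  note ch = atlas_chart[OF MX c] and inj = diffeo_inj[OF df]
  obtain h \<gamma> v where h: "h > 0" and \<gamma>0: "\<gamma> 0 = x0" and v00: "v 0 = v0"
    and \<gamma>: "\<And>t. t \<in> {-h<..<h} \<Longrightarrow> \<gamma> t \<in> coord_dom c \<and> (\<gamma> has_vector_derivative v t) (at t)"
    and v': "(v has_vector_derivative - spray (conn (g c)) x0 v0) (at 0)"
    and l: "geodesic X A g (-h) h (\<lambda>t. chart_inv c (\<gamma> t))"
    using geodesic_exists[OF GR c x0 v0] by blast
  let ?l = "\<lambda>t. chart_inv c (\<gamma> t)"
  have "geodesic Y B gbar (-h) h (f \<circ> ?l)" using f l by (simp add: geodesic_mapping_def)
  moreover have "?e \<in> B" by (rule push_chart_in_atlas[OF df MX MY c])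
  moreover have "(f \<circ> ?l) 0 \<in> fst ?e"
    using chart_inv_in[of "\<gamma> 0" c] x0 \<gamma>0 by (simp add: push_chart_sel)
  ultimately have ap: "autoparallel_at (conn (gbar ?e)) (snd ?e \<circ> (f \<circ> ?l)) 0"
    unfolding geodesic_def using h by simp
  have ev: "\<forall>\<^sub>F s in nhds 0. s \<in> {-h<..<h}" using h by (intro eventually_nhds_in_open) auto
  then have "\<forall>\<^sub>F s in nhds 0. (snd ?e \<circ> (f \<circ> ?l)) s = \<gamma> s"
  proof eventually_elim
    case (elim s)
    have s: "\<gamma> s \<in> coord_dom c" using \<gamma>[OF elim] by blast
    show ?case
      using push_chart_apply[OF inj chart_dom_subset[OF ch] chart_inv_in[OF s]] chart_chart_inv[OF s] by simp
  qed
  then have ap': "autoparallel_at (conn (gbar ?e)) \<gamma> 0" using ap by (rule autoparallel_at_cong)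
  have "\<forall>\<^sub>F s in nhds 0. (\<gamma> has_vector_derivative v s) (at s)"
    using ev by eventually_elim (use \<gamma> in blast)
  from autoparallel_at_unique[OF this v' ap'] show ?thesis using \<gamma>0 v00 by simp
qed

lemma mapping_covector_proj_related:
  fixes c :: "('a, 'n::finite) chart" and Y :: "'b topology"
  assumes GR: "gen_riemannian X A g" and MY: "smooth_manifold Y B"
    and f: "geodesic_mapping X A g Y B gbar f" and eq: "equitorsion X A g gbar f"
    and c: "c \<in> A" and x: "x \<in> coord_dom c"
  shows "proj_related (conn (g c)) (conn (gbar (push_chart X f c))) x (mapping_covector X g gbar f c x)"
proof -
  have "torsion (conn (gbar (push_chart X f c))) h j k x = torsion (conn (g c)) h j k x" for h j k
    using eq c x by (simp add: equitorsion_def)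
  from proj_relatedI[OF this geodesic_mapping_spray[OF GR MY f c x]]
  obtain w where w: "proj_related (conn (g c)) (conn (gbar (push_chart X f c))) x w" by blast
  have "mapping_covector X g gbar f c x = w"
    unfolding mapping_covector_def by (rule proj_related_covector[OF w])
  with w show ?thesis by simp
qed

text \<open>Smoothness is read off from the formula for the covector in terms of the connection coefficients.
  The transformation law follows by subtracting those of the two sprays, because both have the same
  inhomogeneous term: what remains compares the multiples \<open>2 * (w c x \<bullet> v)\<close> and
  \<open>2 * (w d (trans_map c d x) \<bullet> (jac_mat c d x *v v))\<close> of the same nonzero vector.\<close>

lemma proj_related_covector_field:
  fixes A :: "('a, 'n::finite) chart set"
  assumes GR: "gen_riemannian X A g" and GR': "gen_riemannian X A gbar"
    and P: "\<And>c x. c \<in> A \<Longrightarrow> x \<in> coord_dom c \<Longrightarrow> proj_related (conn (g c)) (conn (gbar c)) x (w c x)"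
  shows "covector_field A w"
  unfolding covector_field_def
proof (intro conjI ballI allI)
  have M: "smooth_manifold X A" using GR by (simp add: gen_riemannian_def)
  fix c assume c: "c \<in> A"
  have op: "open (coord_dom c)" using chart_open_dom atlas_chart[OF M c] by blast
  have sm: "smooth_on (coord_dom c) (conn (g c) h j k)" "smooth_on (coord_dom c) (conn (gbar c) h j k)" for h j k
    using GR GR' c by (auto intro!: smooth_on_conn[OF op] simp: gen_riemannian_def tensor02_field_def)
  show "smooth_vec_on (coord_dom c) (w c)"
  proof (rule smooth_vec_on_cong[OF op])
    show "smooth_vec_on (coord_dom c) (\<lambda>x. \<chi> i. (\<Sum>a\<in>UNIV. conn (gbar c) a i a x - conn (g c) a i a x) / (real CARD('n) + 1))"
      unfolding smooth_vec_on_def vec_lambda_beta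
      by (intro allI smooth_on_divide smooth_on_sum smooth_on_diff smooth_on_const op sm) linarith
    show "(\<chi> i. (\<Sum>a\<in>UNIV. conn (gbar c) a i a x - conn (g c) a i a x) / (real CARD('n) + 1)) = w c x"
      if "x \<in> coord_dom c" for x by (rule proj_related_covector[OF P[OF c that]])
  qed
  fix d x i assume d: "d \<in> A" and x: "x \<in> overlap c d"
  note ch = atlas_chart[OF M c] atlas_chart[OF M d]
  let ?J = "jac_mat c d x" and ?T = "trans_map c d x"
  have xc: "x \<in> coord_dom c" using x overlap_subset by blast
  have Tx: "?T \<in> coord_dom d" using trans_map_overlap(1)[OF ch x] overlap_subset by blast
  let ?v = "axis i (1::real) :: real^'n"
  have v0: "?J *v ?v \<noteq> 0"
    using jac_mat_inverse[OF M c d x, of ?v] by (metis axis_eq_0_iff matrix_vector_mult_0_right zero_neq_one)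
  have "?J *v (spray (conn (gbar c)) x ?v - spray (conn (g c)) x ?v)
     = spray (conn (gbar d)) ?T (?J *v ?v) - spray (conn (g d)) ?T (?J *v ?v)"
    by (simp add: matrix_vector_mult_diff_distrib spray_conn_transform[OF GR c d x] spray_conn_transform[OF GR' c d x])
  then have "(2 * (w c x \<bullet> ?v)) *\<^sub>R (?J *v ?v) = (2 * (w d ?T \<bullet> (?J *v ?v))) *\<^sub>R (?J *v ?v)"
    using proj_related_spray[OF P[OF c xc], of ?v] proj_related_spray[OF P[OF d Tx], of "?J *v ?v"]
    by (simp add: matrix_vector_mult_scaleR)
  then have "w c x \<bullet> ?v = w d ?T \<bullet> (?J *v ?v)" using v0 by simp
  then show "w c x $ i = (\<Sum>a\<in>UNIV. jac c d x a i * w d ?T $ a)"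
    by (simp add: inner_axis matrix_vector_mult_basis column_def jac_mat_def inner_vec_def mult.commute sum_axis_mult)
qed

section \<open>The identity as a geodesic mapping\<close>

lemma conn_cong_open:
  assumes "open S" "x \<in> S" "\<And>y. y \<in> S \<Longrightarrow> G y = G' y"
  shows "conn G i j k x = conn G' i j k x"
proof -
  have "pd k (\<lambda>y. G y $ i $ j) x = pd k (\<lambda>y. G' y $ i $ j) x" for i j k
    by (rule pd_cong_open[OF assms(1,2)]) (simp add: assms(3))
  moreover have "sym_part G x = sym_part G' x" by (simp add: sym_part_def assms(3)[OF assms(2)])
  ultimately show ?thesis by (simp add: conn_def conn_low_def sym_inv_def)
qed

text \<open>The inverse taken in \<open>diffeo\<close> is arbitrary outside \<open>topspace X\<close>, so it need not be the
  identity function; smoothness is therefore shown for every function that is the identity on the space.\<close>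

lemma diffeo_id:
  fixes A :: "('a, 'n::finite) chart set"
  assumes M: "smooth_manifold X A"
  shows "diffeo X A X A (\<lambda>p. p)"
proof -
  let ?i = "inv_into (topspace X) (\<lambda>p. p)"
  have i: "?i p = p" if "p \<in> topspace X" for p using inv_into_f_f[of "\<lambda>p. p" "topspace X" p] that by simp
  have sm: "smooth_map X A X A f" if f: "\<And>p. p \<in> topspace X \<Longrightarrow> f p = p" for f
    unfolding smooth_map_def
  proof (intro conjI ballI)
    show "continuous_map X X f"
      by (rule continuous_map_eq[of X X "\<lambda>p. p"]) (simp_all add: f)
    fix c d assume c: "c \<in> A" and d: "d \<in> A"
    note ch = atlas_chart[OF M c] atlas_chart[OF M d]
    have f': "f p = p" if "p \<in> fst c" for p using f that chart_dom_subset[OF ch(1)] by blast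
    have "{p \<in> fst c. f p \<in> fst d} = fst c \<inter> fst d" using f' by auto
    then have ov: "snd c ` {p \<in> fst c. f p \<in> fst d} = overlap c d" by (simp add: overlap_def)
    show "smooth_vec_on (snd c ` {p \<in> fst c. f p \<in> fst d}) (snd d \<circ> f \<circ> chart_inv c)"
      unfolding ov
    proof (rule smooth_vec_on_cong[OF overlap_open[OF ch]])
      show "smooth_vec_on (overlap c d) (trans_map c d)"
        using M c d by (simp add: smooth_manifold_def compatible_def)
      fix x assume "x \<in> overlap c d"
      then have "chart_inv c x \<in> fst c" using overlap_subset chart_inv_in by blast
      then show "trans_map c d x = (snd d \<circ> f \<circ> chart_inv c) x" by (simp add: trans_map_def f')
    qed
  qed
  show ?thesis unfolding diffeo_def using sm[of "\<lambda>p. p"] sm[of ?i] i by (simp add: bij_betw_def)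
qed

text \<open>The chart \<open>push_chart X (\<lambda>p. p) c\<close> need not equal \<open>c\<close>, since the two coordinate maps may differ
  outside the domain, and a field assigns components to each chart separately. The transformation
  law with identity Jacobian makes the components agree.\<close>

lemma tensor02_push_chart_id:
  fixes c :: "('a, 'n::finite) chart"
  assumes M: "smooth_manifold X A" and G: "tensor02_field A G" and c: "c \<in> A" and x: "x \<in> coord_dom c"
  shows "G (push_chart X (\<lambda>p. p) c) x = G c x"
proof -
  let ?e = "push_chart X (\<lambda>p. p) c"
  note df = diffeo_id[OF M]
  note inj = diffeo_inj[OF df] and ch = atlas_chart[OF M c]
  have e: "?e \<in> A" by (rule push_chart_in_atlas[OF df M M c])
  have ov: "x \<in> overlap c ?e" using x by (simp add: overlap_def push_chart_sel(1) coord_dom_def)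
  have T: "trans_map c ?e y = y" if y: "y \<in> coord_dom c" for y
    using push_chart_apply[OF inj chart_dom_subset[OF ch] chart_inv_in[OF y]] chart_chart_inv[OF y]
    by (simp add: trans_map_def)
  have J: "jac c ?e x a i = kron a i" for a i
  proof -
    have "jac c ?e x a i = pd i (\<lambda>y. y $ a) x"
      unfolding jac_def by (rule pd_cong_open[OF chart_open_dom[OF ch] x]) (simp add: T)
    also have "\<dots> = axis i 1 $ a"
      by (rule pd_eq) (rule bounded_linear_imp_has_derivative[OF bounded_linear_vec_nth])
    finally show ?thesis by (simp add: axis_def kron_def)
  qed
  have "G c x $ i $ j = G ?e x $ i $ j" for i j
  proof -
    have "G c x $ i $ j = (\<Sum>a\<in>UNIV. \<Sum>b\<in>UNIV. kron a i * kron b j * G ?e x $ a $ b)"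
      using G c e ov T[OF x] by (simp add: tensor02_field_def J)
    also have "\<dots> = (\<Sum>a\<in>UNIV. kron a i * (\<Sum>b\<in>UNIV. kron b j * G ?e x $ a $ b))"
      by (simp add: sum_distrib_left mult.assoc)
    finally show ?thesis by (simp add: sum_kron)
  qed
  then show ?thesis by (simp add: vec_eq_iff)
qed

lemma conn_push_chart_id:
  fixes c :: "('a, 'n::finite) chart"
  assumes "smooth_manifold X A" "tensor02_field A G" "c \<in> A" "x \<in> coord_dom c"
  shows "conn (G (push_chart X (\<lambda>p. p) c)) i j k x = conn (G c) i j k x"
  by (rule conn_cong_open[OF chart_open_dom[OF atlas_chart[OF assms(1,3)]] assms(4)])
    (rule tensor02_push_chart_id[OF assms(1-3)])

text \<open>Both metrics live on the same charts, so that preservation of geodesics is a pointwise statement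
  about the two connections in each chart.\<close>

lemma geodesic_mapping_id:
  fixes A :: "('a, 'n::finite) chart set"
  assumes M: "smooth_manifold X A"
    and P: "\<And>c x. c \<in> A \<Longrightarrow> x \<in> coord_dom c \<Longrightarrow> proj_related (conn (g c)) (conn (gbar c)) x (w c x)"
  shows "geodesic_mapping X A g X A gbar (\<lambda>p. p)"
  unfolding geodesic_mapping_def
proof (intro conjI allI impI)
  show "diffeo X A X A (\<lambda>p. p)" by (rule diffeo_id[OF M])
  fix \<alpha> \<beta> l assume l: "geodesic X A g \<alpha> \<beta> l"
  have "autoparallel_at (conn (gbar c)) (snd c \<circ> l) t"
    if c: "c \<in> A" and t: "t \<in> {\<alpha><..<\<beta>}" and lt: "l t \<in> fst c" for c t
  proof (rule autoparallel_at_proj_related)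
    show "autoparallel_at (conn (g c)) (snd c \<circ> l) t" using l c t lt by (simp add: geodesic_def)
    have "(snd c \<circ> l) t \<in> coord_dom c" using lt by (simp add: coord_dom_def)
    from P[OF c this]
    show "proj_related (conn (g c)) (conn (gbar c)) ((snd c \<circ> l) t) (w c ((snd c \<circ> l) t))" .
  qed
  then show "geodesic X A gbar \<alpha> \<beta> ((\<lambda>p. p) \<circ> l)"
    using l unfolding geodesic_def by (simp add: o_def)
qed

section \<open>The characterisation\<close>

lemma kaehlerian_algebra_iff:
  assumes "det (sym_part G x) \<noteq> 0"
    and "\<And>h i. (\<Sum>p\<in>UNIV. F x $ h $ p * F x $ p $ i) = - kron h i"
  shows "(\<forall>i j. (\<Sum>a\<in>UNIV. F x $ a $ i * sym_part G x $ a $ j) + (\<Sum>a\<in>UNIV. F x $ a $ j * sym_part G x $ a $ i) = 0) \<longleftrightarrow>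
    (\<forall>i j. (\<Sum>p\<in>UNIV. \<Sum>q\<in>UNIV. sym_part G x $ p $ q * F x $ p $ i * F x $ q $ j) = sym_part G x $ i $ j) \<and>
    (\<forall>i j. sym_inv G x $ i $ j = (\<Sum>p\<in>UNIV. \<Sum>q\<in>UNIV. sym_inv G x $ p $ q * F x $ i $ p * F x $ j $ q))"
  unfolding sym_inv_def by (rule hermitian_iff[OF sym_part_sym assms])

theorem theorem2p10:
  fixes X :: "'a topology"
    and A :: "('a, 'n::finite) chart set"
    and g :: "('a, 'n) field2"
  assumes "gen_riemannian X A g"
  shows "admits_equitorsion_mapping_onto_kaehlerian1 X A g \<longleftrightarrow>
    (\<exists>(gbar :: ('a, 'n) field2) (Fbar :: ('a, 'n) field2) (\<psi> :: ('a, 'n) field1).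
       tensor02_field A gbar \<and> tensor11_field A Fbar \<and>
       covector_field A \<psi> \<and> nonzero_covector A \<psi> \<and>
       (\<forall>c\<in>A. \<forall>x\<in>coord_dom c.
          (\<forall>h i j. torsion (conn (gbar c)) h i j x - torsion (conn (g c)) h i j x = 0) \<and>
          (\<forall>i j k. cov4_low (conn (g c)) (sym_part (gbar c)) i j k x =
             2 * \<psi> c x $ k * sym_part (gbar c) x $ i $ j
             + \<psi> c x $ i * sym_part (gbar c) x $ j $ k
             + \<psi> c x $ j * sym_part (gbar c) x $ i $ k) \<and>
          (\<forall>h i k. cov4_mixed (conn (g c)) (Fbar c) h i k x =
             cov4_mixed (conn (gbar c)) (Fbar c) h i k x
             - (\<Sum>p\<in>UNIV. \<psi> c x $ p * kron h k * Fbar c x $ p $ i)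
             + \<psi> c x $ i * Fbar c x $ h $ k) \<and>
          det (sym_part (gbar c) x) \<noteq> 0 \<and>
          (\<forall>i j. (\<Sum>a\<in>UNIV. Fbar c x $ a $ i * sym_part (gbar c) x $ a $ j)
                + (\<Sum>a\<in>UNIV. Fbar c x $ a $ j * sym_part (gbar c) x $ a $ i) = 0) \<and>
          (\<forall>h i. (\<Sum>a\<in>UNIV. Fbar c x $ h $ a * Fbar c x $ a $ i) = - kron h i) \<and>
          structure_parallel (conn (gbar c)) (Fbar c) x))"
  (is "?L \<longleftrightarrow> ?R")
proof -
  have MX: "smooth_manifold X A" using assms by (simp add: gen_riemannian_def)
  show ?thesis
  proof
    assume ?L
    then obtain Y :: "'a topology" and B :: "('a, 'n) chart set" and G F f
      where K: "gen_kaehlerian1 Y B G F" and f: "geodesic_mapping X A g Y B G f"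
        and eq: "equitorsion X A g G f" and nz: "nonzero_covector A (mapping_covector X g G f)"
      unfolding admits_equitorsion_mapping_onto_kaehlerian1_def by blast
    have GRY: "gen_riemannian Y B G" and tF: "tensor11_field B F" using K by (simp_all add: gen_kaehlerian1_def)
    have MY: "smooth_manifold Y B" and tG: "tensor02_field B G" using GRY by (simp_all add: gen_riemannian_def)
    have df: "diffeo X A Y B f" using f by (simp add: geodesic_mapping_def)
    note inj = diffeo_inj[OF df]
    define gbar where "gbar c = G (push_chart X f c)" for c
    define Fbar where "Fbar c = F (push_chart X f c)" for c
    define \<psi> where "\<psi> = mapping_covector X g G f"
    have tg: "tensor02_field A gbar" unfolding gbar_def by (rule tensor02_pullback[OF df MX MY tG])
    have tf: "tensor11_field A Fbar" unfolding Fbar_def by (rule tensor11_pullback[OF df MX MY tF])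
    have pB: "push_chart X f c \<in> B" if "c \<in> A" for c by (rule push_chart_in_atlas[OF df MX MY that])
    have pd: "coord_dom (push_chart X f c) = coord_dom c" if "c \<in> A" for c
      by (rule coord_dom_push_chart[OF inj chart_dom_subset[OF atlas_chart[OF MX that]]])
    have nd: "det (sym_part (gbar c) x) \<noteq> 0" if "c \<in> A" "x \<in> coord_dom c" for c x
      using GRY pB[OF that(1)] pd[OF that(1)] that(2) by (simp add: gen_riemannian_def gbar_def)
    have GR': "gen_riemannian X A gbar" using MX tg nd by (simp add: gen_riemannian_def)
    have P: "proj_related (conn (g c)) (conn (gbar c)) x (\<psi> c x)" if "c \<in> A" "x \<in> coord_dom c" for c x
      unfolding gbar_def \<psi>_def by (rule mapping_covector_proj_related[OF assms MY f eq that])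
    have cov: "covector_field A \<psi>" by (rule proj_related_covector_field[OF assms GR' P])
    show ?R
    proof (rule exI[of _ gbar], rule exI[of _ Fbar], rule exI[of _ \<psi>], intro conjI ballI tg tf cov)
      show "nonzero_covector A \<psi>" unfolding \<psi>_def by (rule nz)
      fix c x assume c: "c \<in> A" and x: "x \<in> coord_dom c"
      note d = tensor02_differentiable[OF MX tg c x]
      have Kc: "(\<forall>h i. (\<Sum>p\<in>UNIV. Fbar c x $ h $ p * Fbar c x $ p $ i) = - kron h i) \<and>
        (\<forall>i j. (\<Sum>p\<in>UNIV. \<Sum>q\<in>UNIV. sym_part (gbar c) x $ p $ q * Fbar c x $ p $ i * Fbar c x $ q $ j)
               = sym_part (gbar c) x $ i $ j) \<and>
        (\<forall>i j. sym_inv (gbar c) x $ i $ j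
               = (\<Sum>p\<in>UNIV. \<Sum>q\<in>UNIV. sym_inv (gbar c) x $ p $ q * Fbar c x $ i $ p * Fbar c x $ j $ q)) \<and>
        structure_parallel (conn (gbar c)) (Fbar c) x"
        using K pB[OF c] x pd[OF c] unfolding gen_kaehlerian1_def gbar_def Fbar_def by simp
      show "\<forall>h i j. torsion (conn (gbar c)) h i j x - torsion (conn (g c)) h i j x = 0"
        using eq c x by (simp add: equitorsion_def gbar_def)
      show "\<forall>i j k. cov4_low (conn (g c)) (sym_part (gbar c)) i j k x =
             2 * \<psi> c x $ k * sym_part (gbar c) x $ i $ j
             + \<psi> c x $ i * sym_part (gbar c) x $ j $ k
             + \<psi> c x $ j * sym_part (gbar c) x $ i $ k"
        by (intro allI metric_equation_of_proj_related[OF nd[OF c x] d P[OF c x]])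
      show "\<forall>h i k. cov4_mixed (conn (g c)) (Fbar c) h i k x =
             cov4_mixed (conn (gbar c)) (Fbar c) h i k x
             - (\<Sum>p\<in>UNIV. \<psi> c x $ p * kron h k * Fbar c x $ p $ i)
             + \<psi> c x $ i * Fbar c x $ h $ k"
        by (intro allI structure_equation_of_proj_related[OF P[OF c x]])
      show "det (sym_part (gbar c) x) \<noteq> 0" by (rule nd[OF c x])
      show "\<forall>i j. (\<Sum>a\<in>UNIV. Fbar c x $ a $ i * sym_part (gbar c) x $ a $ j)
                + (\<Sum>a\<in>UNIV. Fbar c x $ a $ j * sym_part (gbar c) x $ a $ i) = 0"
        using Kc kaehlerian_algebra_iff[OF nd[OF c x], of "Fbar c"] by blast
      show "\<forall>h i. (\<Sum>a\<in>UNIV. Fbar c x $ h $ a * Fbar c x $ a $ i) = - kron h i" using Kc by blast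
      show "structure_parallel (conn (gbar c)) (Fbar c) x" using Kc by blast
    qed
  next
    assume ?R
    then obtain gbar Fbar :: "('a, 'n) field2" and \<psi> :: "('a, 'n) field1"
      where tg: "tensor02_field A gbar" and tf: "tensor11_field A Fbar" and nz: "nonzero_covector A \<psi>"
        and all: "\<forall>c\<in>A. \<forall>x\<in>coord_dom c.
          (\<forall>h i j. torsion (conn (gbar c)) h i j x - torsion (conn (g c)) h i j x = 0) \<and>
          (\<forall>i j k. cov4_low (conn (g c)) (sym_part (gbar c)) i j k x =
             2 * \<psi> c x $ k * sym_part (gbar c) x $ i $ j
             + \<psi> c x $ i * sym_part (gbar c) x $ j $ k
             + \<psi> c x $ j * sym_part (gbar c) x $ i $ k) \<and>
          (\<forall>h i k. cov4_mixed (conn (g c)) (Fbar c) h i k x =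
             cov4_mixed (conn (gbar c)) (Fbar c) h i k x
             - (\<Sum>p\<in>UNIV. \<psi> c x $ p * kron h k * Fbar c x $ p $ i)
             + \<psi> c x $ i * Fbar c x $ h $ k) \<and>
          det (sym_part (gbar c) x) \<noteq> 0 \<and>
          (\<forall>i j. (\<Sum>a\<in>UNIV. Fbar c x $ a $ i * sym_part (gbar c) x $ a $ j)
                + (\<Sum>a\<in>UNIV. Fbar c x $ a $ j * sym_part (gbar c) x $ a $ i) = 0) \<and>
          (\<forall>h i. (\<Sum>a\<in>UNIV. Fbar c x $ h $ a * Fbar c x $ a $ i) = - kron h i) \<and>
          structure_parallel (conn (gbar c)) (Fbar c) x"
      by (elim exE conjE)
    have at: "(\<forall>h i j. torsion (conn (gbar c)) h i j x = torsion (conn (g c)) h i j x) \<and>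
          (\<forall>i j k. cov4_low (conn (g c)) (sym_part (gbar c)) i j k x =
             2 * \<psi> c x $ k * sym_part (gbar c) x $ i $ j
             + \<psi> c x $ i * sym_part (gbar c) x $ j $ k
             + \<psi> c x $ j * sym_part (gbar c) x $ i $ k) \<and>
          det (sym_part (gbar c) x) \<noteq> 0 \<and>
          (\<forall>i j. (\<Sum>a\<in>UNIV. Fbar c x $ a $ i * sym_part (gbar c) x $ a $ j)
                + (\<Sum>a\<in>UNIV. Fbar c x $ a $ j * sym_part (gbar c) x $ a $ i) = 0) \<and>
          (\<forall>h i. (\<Sum>a\<in>UNIV. Fbar c x $ h $ a * Fbar c x $ a $ i) = - kron h i) \<and>
          structure_parallel (conn (gbar c)) (Fbar c) x" if "c \<in> A" "x \<in> coord_dom c" for c x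
      using bspec[OF bspec[OF all that(1)] that(2)] by (elim conjE, intro conjI) simp_all
    have P: "proj_related (conn (g c)) (conn (gbar c)) x (\<psi> c x)" if c: "c \<in> A" and x: "x \<in> coord_dom c" for c x
      by (rule proj_related_of_metric_equation[OF _ tensor02_differentiable[OF MX tg c x]])
        (use at[OF c x] in blast)+
    have GR': "gen_riemannian X A gbar" unfolding gen_riemannian_def using MX tg at by blast
    have K: "gen_kaehlerian1 X A gbar Fbar"
      unfolding gen_kaehlerian1_def
    proof (intro conjI GR' tf ballI)
      fix c x assume c: "c \<in> A" and x: "x \<in> coord_dom c"
      note a = at[OF c x]
      have nd: "det (sym_part (gbar c) x) \<noteq> 0"
        and sq: "\<And>h i. (\<Sum>a\<in>UNIV. Fbar c x $ h $ a * Fbar c x $ a $ i) = - kron h i" using a by blast+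
      show "\<forall>h i. (\<Sum>p\<in>UNIV. Fbar c x $ h $ p * Fbar c x $ p $ i) = - kron h i" using sq by blast
      show "structure_parallel (conn (gbar c)) (Fbar c) x" using a by blast
      show "\<forall>i j. (\<Sum>p\<in>UNIV. \<Sum>q\<in>UNIV. sym_part (gbar c) x $ p $ q * Fbar c x $ p $ i * Fbar c x $ q $ j)
               = sym_part (gbar c) x $ i $ j"
        and "\<forall>i j. sym_inv (gbar c) x $ i $ j
               = (\<Sum>p\<in>UNIV. \<Sum>q\<in>UNIV. sym_inv (gbar c) x $ p $ q * Fbar c x $ i $ p * Fbar c x $ j $ q)"
        using a kaehlerian_algebra_iff[where F = "Fbar c", OF nd sq] by blast+
    qed
    have cn: "conn (gbar (push_chart X (\<lambda>p. p) c)) i j k x = conn (gbar c) i j k x"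
      if "c \<in> A" "x \<in> coord_dom c" for c x i j k
      by (rule conn_push_chart_id[OF MX tg that])
    have eq: "equitorsion X A g gbar (\<lambda>p. p)"
      unfolding equitorsion_def
    proof (intro ballI allI)
      fix c x i j k assume c: "c \<in> A" and x: "x \<in> coord_dom c"
      have "torsion (conn (gbar c)) i j k x = torsion (conn (g c)) i j k x" using at[OF c x] by blast
      then show "torsion (conn (gbar (push_chart X (\<lambda>p. p) c))) i j k x = torsion (conn (g c)) i j k x"
        by (simp add: torsion_def cn[OF c x])
    qed
    have mc: "mapping_covector X g gbar (\<lambda>p. p) c x = \<psi> c x" if c: "c \<in> A" and x: "x \<in> coord_dom c" for c x
      unfolding mapping_covector_def cn[OF c x] by (rule proj_related_covector[OF P[OF c x]])
    have gm: "geodesic_mapping X A g X A gbar (\<lambda>p. p)"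
      by (rule geodesic_mapping_id[OF MX]) (rule P)
    have "nonzero_covector A (mapping_covector X g gbar (\<lambda>p. p))"
      using nz unfolding nonzero_covector_def by (metis mc)
    then show ?L
      unfolding admits_equitorsion_mapping_onto_kaehlerian1_def
      using K gm eq by blast
  qed
qed

end
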